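(* Let $r,d,k\in\mathbb N$ and let $M_1,\dots,M_k\in\mathbb R^{d^r\times d^r}$ be i.i.d., mean-zero, random symmetric matrices such that, for some $R,\sigma>0$ and every $i$: (1) $\|M_i\|_2\le R$ almost surely; (2) $\mathbb E[\langle u^{\otimes r},M_i^2u^{\otimes r}\rangle]\preceq\sigma^2\|u\|^{2r}$, both sides being polynomials in $u=(u_1,\dots,u_d)$. Then $$\mathbb E\left[\max_{\tilde{\mathbb E}}\tilde{\mathbb E}\Big[\sum_{i\le k}\langle u^{\otimes r},M_iu^{\otimes r}\rangle\Big]\right]\le\frac{2(\log 2+r\log d)}{3}\,R+2\sqrt{2k(\log 2+r\log d)}\;\sigma,$$ where the maximum is over all degree-$2r$ pseudoexpectations $\tilde{\mathbb E}$ in variables $u=(u_1,\dots,u_d)$ satisfying $\{\|u\|^2=1\}$.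
   Context: $\|\cdot\|_2$ is the spectral norm. For polynomials $p,q$ in $u$, $p\preceq q$ means that $q-p$ is a sum of squares of polynomials. A degree-$D$ pseudoexpectation is a linear functional $\tilde{\mathbb E}$ on real polynomials of degree at most $D$ in the variables with $\tilde{\mathbb E}1=1$ and $\tilde{\mathbb E}p^2\ge0$ whenever $\deg p\le D/2$; it satisfies an equation $q=0$ if $\tilde{\mathbb E}[pq]=0$ for all $p$ with $\deg(pq)\le D$. *)

theory Defs
  imports "HOL-Probability.Probability" "HOL-Library.Poly_Mapping"
begin

text \<open>
  Real polynomials in variables indexed by \<open>'d\<close>: a monomial is its finitely supported exponent
  vector, a polynomial maps monomials to coefficients.
\<close>

type_synonym 'd rpoly = "('d \<Rightarrow>\<^sub>0 nat) \<Rightarrow>\<^sub>0 real"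

definition var :: "'d \<Rightarrow> 'd rpoly" where
  "var i = Poly_Mapping.single (Poly_Mapping.single i 1) 1"

definition cst :: "real \<Rightarrow> 'd rpoly" where
  "cst c = Poly_Mapping.single 0 c"

definition mdeg :: "('d \<Rightarrow>\<^sub>0 nat) \<Rightarrow> nat" where
  "mdeg m = (\<Sum>i\<in>Poly_Mapping.keys m. Poly_Mapping.lookup m i)"

text \<open>The zero polynomial gets total degree 0, hence satisfies every degree bound.\<close>

definition tdeg :: "'d rpoly \<Rightarrow> nat" where
  "tdeg p = Max (insert 0 (mdeg ` Poly_Mapping.keys p))"

definition norm_sq :: "'d::finite rpoly" where
  "norm_sq = (\<Sum>i\<in>UNIV. var i ^ 2)"

definition sos :: "'d rpoly \<Rightarrow> bool" where
  "sos p \<longleftrightarrow> (\<exists>qs. p = (\<Sum>q\<leftarrow>qs. q ^ 2))"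

definition sos_le :: "'d rpoly \<Rightarrow> 'd rpoly \<Rightarrow> bool"  (infix \<open>\<preceq>\<close> 50) where
  "p \<preceq> q \<longleftrightarrow> sos (q - p)"

text \<open>
  A functional on polynomials of degree at most \<open>D\<close> is represented by a function on all
  polynomials; its values on polynomials of larger degree are irrelevant.
\<close>

definition pseudoexpectation :: "nat \<Rightarrow> ('d rpoly \<Rightarrow> real) \<Rightarrow> bool" where
  "pseudoexpectation D L \<longleftrightarrow>
     (\<forall>p q. tdeg p \<le> D \<longrightarrow> tdeg q \<le> D \<longrightarrow> L (p + q) = L p + L q) \<and>
     (\<forall>c p. tdeg p \<le> D \<longrightarrow> L (cst c * p) = c * L p) \<and>
     L 1 = 1 \<and>
     (\<forall>p. 2 * tdeg p \<le> D \<longrightarrow> L (p ^ 2) \<ge> 0)"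

definition satisfies_eq :: "nat \<Rightarrow> ('d rpoly \<Rightarrow> real) \<Rightarrow> 'd rpoly \<Rightarrow> bool" where
  "satisfies_eq D L q \<longleftrightarrow> (\<forall>p. tdeg (p * q) \<le> D \<longrightarrow> L (p * q) = 0)"

definition sphere_pseudoexpectations :: "nat \<Rightarrow> ('d::finite rpoly \<Rightarrow> real) set" where
  "sphere_pseudoexpectations D =
     {L. pseudoexpectation D L \<and> satisfies_eq D L (norm_sq - 1)}"

text \<open>
  \<open>GREATEST\<close> is unspecified when no maximum is attained, so attainment has to be stated
  separately.
\<close>

definition max_pseudoexpectation :: "nat \<Rightarrow> 'd::finite rpoly \<Rightarrow> real" where
  "max_pseudoexpectation D p =
     (GREATEST x. x \<in> (\<lambda>L. L p) ` sphere_pseudoexpectations D)"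

text \<open>
  The coordinates of the \<open>r\<close>-fold tensor power of \<open>\<real>\<^sup>d\<close> are indexed by the \<open>d\<^sup>r\<close> multi-indices
  \<open>'r \<Rightarrow> 'd\<close>, where \<open>r = CARD('r)\<close> and \<open>d = CARD('d)\<close>.
\<close>

definition tensor_power :: "('r::finite \<Rightarrow> 'd) \<Rightarrow> 'd rpoly" where
  "tensor_power a = (\<Prod>j\<in>UNIV. var (a j))"

definition tensor_form :: "real ^ ('r::finite \<Rightarrow> 'd::finite) ^ ('r \<Rightarrow> 'd) \<Rightarrow> 'd rpoly" where
  "tensor_form A =
     (\<Sum>a\<in>UNIV. tensor_power a * (\<Sum>b\<in>UNIV. cst (A $ a $ b) * tensor_power b))"

text \<open>
  Expectation of a random polynomial, taken coefficientwise.  The use of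
  \<open>Abs_poly_mapping\<close> is meaningful only if finitely many coefficients have nonzero mean; the
  two lemmas below show that this is so for random forms.
\<close>

definition expectation_poly :: "'w measure \<Rightarrow> ('w \<Rightarrow> 'd rpoly) \<Rightarrow> 'd rpoly" where
  "expectation_poly P F =
     Poly_Mapping.Abs_poly_mapping (\<lambda>m. \<integral>\<omega>. Poly_Mapping.lookup (F \<omega>) m \<partial>P)"

lemma lookup_expectation_poly:
  assumes "finite K" "\<And>\<omega>. Poly_Mapping.keys (F \<omega>) \<subseteq> K"
  shows "Poly_Mapping.lookup (expectation_poly P F) m = (\<integral>\<omega>. Poly_Mapping.lookup (F \<omega>) m \<partial>P)"
proof -
  have "(\<integral>\<omega>. Poly_Mapping.lookup (F \<omega>) m \<partial>P) = 0" if "m \<notin> K" for m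
  proof -
    have "Poly_Mapping.lookup (F \<omega>) m = 0" for \<omega>
      using assms(2) that by (meson in_keys_iff subsetD)
    then show ?thesis by simp
  qed
  then have "{m. (\<integral>\<omega>. Poly_Mapping.lookup (F \<omega>) m \<partial>P) \<noteq> 0} \<subseteq> K" by auto
  with assms(1) have "finite {m. (\<integral>\<omega>. Poly_Mapping.lookup (F \<omega>) m \<partial>P) \<noteq> 0}"
    by (rule finite_subset[rotated])
  then show ?thesis
    unfolding expectation_poly_def by simp
qed

lemma lookup_expectation_tensor_form:
  fixes A :: "'w \<Rightarrow> real ^ ('r::finite \<Rightarrow> 'd::finite) ^ ('r \<Rightarrow> 'd)"
  shows
  "Poly_Mapping.lookup (expectation_poly P (\<lambda>\<omega>. tensor_form (A \<omega>))) m =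
     (\<integral>\<omega>. Poly_Mapping.lookup (tensor_form (A \<omega>)) m \<partial>P)"
proof (rule lookup_expectation_poly)
  let ?K = "\<Union>a\<in>(UNIV :: ('r \<Rightarrow> 'd) set). \<Union>b\<in>(UNIV :: ('r \<Rightarrow> 'd) set). {x + (y + z) | x y z.
      x \<in> Poly_Mapping.keys (tensor_power a) \<and> y \<in> {0} \<and> z \<in> Poly_Mapping.keys (tensor_power b)}"
  show "finite ?K"
    by (intro finite_UN_I finite) (auto intro!: finite_image_set2)
  fix \<omega>
  have "Poly_Mapping.keys (tensor_power a * (cst c * tensor_power b)) \<subseteq>
     {x + (y + z) | x y z. x \<in> Poly_Mapping.keys (tensor_power a) \<and> y \<in> {0} \<and> z \<in> Poly_Mapping.keys (tensor_power b)}"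
    for a b :: "'r \<Rightarrow> 'd" and c
    using keys_mult[of "tensor_power a" "cst c * tensor_power b"] keys_mult[of "cst c" "tensor_power b"]
    by (fastforce simp: cst_def split: if_splits)
  then show "Poly_Mapping.keys (tensor_form (A \<omega>)) \<subseteq> ?K"
    unfolding tensor_form_def sum_distrib_left
    by (intro order_trans[OF keys_sum] UN_mono order_refl)
qed

abbreviation spectral_norm :: "real ^ 'n::finite ^ 'n \<Rightarrow> real" where
  "spectral_norm A \<equiv> onorm ((*v) A)"

end

theory Submission imports Defs "HOL-Real_Asymp.Real_Asymp"
begin

text \<open>
  A pseudoexpectation acts on forms of degree \<open>2r\<close> through its moment matrix
  \<open>X\<^bsub>a,b\<^esub> = L (u\<^sub>a u\<^sub>b)\<close>, a positive semidefinite matrix of trace 1, so the quantity to bound is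
  the supremum of \<open>S \<bullet> X\<close> over a convex set \<open>K\<close> of density matrices, with \<open>S\<close> the sum of the
  \<open>M\<^sub>i\<close>.  The variance hypothesis says that \<open>E M\<^sub>i\<^sup>2 \<bullet> X \<le> \<sigma>\<^sup>2\<close> for \<open>X \<in> K\<close> only.  Instead of the
  usual exponential trace one therefore follows the entropic potential
  \<open>\<Phi> S = (SUP X\<in>K. S \<bullet> X - tr (X log X) / \<eta>)\<close>, which dominates the supremum and satisfies
  \<open>\<Phi> 0 \<le> r log d / \<eta>\<close>.  If \<open>X\<close> is optimal for \<open>S\<close>, then moving to another \<open>Y \<in> K\<close> costs the
  relative entropy of \<open>Y\<close> with respect to \<open>X\<close>, which is at least its value after measuring in an
  eigenbasis of \<open>M\<close>; hence \<open>\<Phi> (S + M) \<le> \<Phi> S + M \<bullet> X + \<eta> * (M\<^sup>2 \<bullet> X)\<close> as long as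
  \<open>\<eta>\<close> times the spectral norm of \<open>M\<close> is at most 3/2 (near-optimal \<open>X\<close> give this up to a small
  error, so no maximizer is needed).  As \<open>X\<close> does not depend on \<open>M\<close>, each summand raises the
  expected potential by at most \<open>\<eta> * \<sigma>\<^sup>2\<close>, and it remains to optimize \<open>\<eta>\<close>.
\<close>

section \<open>Spectral decomposition of symmetric matrices\<close>

definition orthonormal :: "('n::finite \<Rightarrow> real ^ 'n) \<Rightarrow> bool" where
  "orthonormal b \<longleftrightarrow> (\<forall>i j. b i \<bullet> b j = (if i = j then 1 else 0))"

text \<open>The residual \<open>z\<close> is orthogonal to every \<open>b i\<close>. Since
  \<open>CARD('n)\<close> independent vectors span the whole space, it is orthogonal to
  itself.\<close>

lemma orthonormal_expansion:
  assumes "orthonormal b"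
  shows "(\<Sum>i\<in>UNIV. (b i \<bullet> u) *\<^sub>R b i) = u"
proof -
  have bb: "b i \<bullet> b j = (if i = j then 1 else 0)" for i j
    using assms by (simp add: orthonormal_def)
  have inj: "inj b"
    by (rule injI) (metis bb zero_neq_one)
  have "independent (range b)"
  proof (rule pairwise_orthogonal_independent)
    show "pairwise orthogonal (range b)"
      by (auto simp: pairwise_def orthogonal_def bb)
    show "0 \<notin> range b"
      by (metis bb image_iff inner_zero_left zero_neq_one)
  qed
  then have spn: "UNIV \<subseteq> span (range b)"
    by (intro card_ge_dim_independent) (simp_all add: card_image[OF inj])
  define z where "z = u - (\<Sum>i\<in>UNIV. (b i \<bullet> u) *\<^sub>R b i)"
  have "orthogonal z (b j)" for j
    by (simp add: z_def orthogonal_def inner_diff_left inner_sum_left bb inner_commute[of u] if_distrib cong: if_cong)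
  then have "orthogonal z x" if "x \<in> span (range b)" for x
    using that by (auto intro: orthogonal_to_span)
  then have "orthogonal z z"
    using spn by blast
  then show ?thesis
    by (simp add: z_def orthogonal_self)
qed

lemma orthonormal_parseval:
  assumes "orthonormal b"
  shows "(\<Sum>i\<in>UNIV. (b i \<bullet> u) * (b i \<bullet> w)) = u \<bullet> w"
proof -
  have "u \<bullet> w = (\<Sum>i\<in>UNIV. (b i \<bullet> u) *\<^sub>R b i) \<bullet> w"
    using orthonormal_expansion[OF assms] by simp
  then show ?thesis
    by (simp add: inner_sum_left)
qed

lemma symmetric_inner:
  fixes A :: "real ^ 'n::finite ^ 'n"
  assumes "transpose A = A"
  shows "(A *v x) \<bullet> y = x \<bullet> (A *v y)"
  by (metis assms dot_lmul_matrix transpose_matrix_vector)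

text \<open>Parseval is applied to each pair of rows; exchanging the sums turns the Frobenius inner
  product into a sum over the images of the basis vectors.\<close>

lemma inner_matrix_orthonormal:
  fixes A X :: "real ^ 'n::finite ^ 'n"
  assumes "orthonormal b"
  shows "A \<bullet> X = (\<Sum>i\<in>UNIV. (A *v b i) \<bullet> (X *v b i))"
proof -
  have "A \<bullet> X = (\<Sum>k\<in>UNIV. (A $ k) \<bullet> (X $ k))"
    by (simp add: inner_vec_def)
  also have "\<dots> = (\<Sum>k\<in>UNIV. \<Sum>i\<in>UNIV. (b i \<bullet> (A $ k)) * (b i \<bullet> (X $ k)))"
    by (simp add: orthonormal_parseval[OF assms])
  also have "\<dots> = (\<Sum>i\<in>UNIV. \<Sum>k\<in>UNIV. (b i \<bullet> (A $ k)) * (b i \<bullet> (X $ k)))"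
    by (rule sum.swap)
  also have "\<dots> = (\<Sum>i\<in>UNIV. (A *v b i) \<bullet> (X *v b i))"
    by (subst inner_vec_def) (simp add: matrix_mult_dot inner_commute)
  finally show ?thesis .
qed

lemma trace_orthonormal:
  fixes X :: "real ^ 'n::finite ^ 'n"
  assumes "orthonormal b"
  shows "trace X = (\<Sum>i\<in>UNIV. b i \<bullet> (X *v b i))"
proof -
  have "(mat 1 :: real ^ 'n ^ 'n) \<bullet> X = trace X"
    by (simp add: inner_vec_def mat_def trace_def if_distrib if_distribR cong: if_cong)
  then show ?thesis
    using inner_matrix_orthonormal[OF assms, of "mat 1" X] by simp
qed

text \<open>Rayleigh quotient: a maximizer \<open>v\<close> of the quadratic form on the unit sphere
  of \<open>S\<close> is an eigenvector, because the variation along the residual \<open>w\<close>,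
  which stays in \<open>S\<close> by invariance, must vanish to first order.\<close>

lemma symmetric_eigenvector_in_subspace:
  fixes A :: "real ^ 'n::finite ^ 'n"
  assumes sym: "transpose A = A" and S: "subspace S" "\<And>x. x \<in> S \<Longrightarrow> A *v x \<in> S" "S \<noteq> {0}"
  shows "\<exists>v\<in>S. \<exists>l. norm v = 1 \<and> A *v v = l *\<^sub>R v"
proof -
  let ?C = "S \<inter> sphere 0 1"
  obtain x where x: "x \<in> S" "x \<noteq> 0"
    using S(1,3) subspace_0 by blast
  then have "x /\<^sub>R norm x \<in> ?C"
    using S(1) by (simp add: subspace_scale)
  moreover have "compact ?C"
    using S(1) by (simp add: closed_Int_compact closed_subspace)
  moreover have "continuous_on ?C (\<lambda>u. u \<bullet> (A *v u))"
    by (intro continuous_intros linear_continuous_on matrix_vector_mul_bounded_linear)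
  ultimately obtain v where v: "v \<in> ?C" "\<And>u. u \<in> ?C \<Longrightarrow> u \<bullet> (A *v u) \<le> v \<bullet> (A *v v)"
    using continuous_attains_sup[of ?C "\<lambda>u. u \<bullet> (A *v u)"] by blast
  define l where "l = v \<bullet> (A *v v)"
  define g where "g u = l * (u \<bullet> u) - u \<bullet> (A *v u)" for u
  have g_nonneg: "g u \<ge> 0" if "u \<in> S" for u
  proof (cases "u = 0")
    case False
    have "u /\<^sub>R norm u \<in> ?C"
      using S(1) that False by (simp add: subspace_scale)
    from v(2)[OF this] have "(u \<bullet> (A *v u)) / (norm u * norm u) \<le> l"
      by (simp add: l_def matrix_vector_mult_scaleR divide_inverse mult_ac)
    then show ?thesis
      using False by (simp add: g_def dot_square_norm divide_le_eq power2_eq_square)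
  qed (simp add: g_def)
  define w where "w = A *v v - l *\<^sub>R v"
  have vS: "v \<in> S" and vv: "v \<bullet> v = 1"
    using v(1) by (simp_all add: dot_square_norm)
  have wS: "w \<in> S"
    unfolding w_def using S(1,2) vS by (simp add: subspace_diff subspace_scale)
  \<comment> \<open>There is no constant term since \<open>g v = 0\<close>. The linear term would
    make \<open>g\<close> negative for small positive \<open>t\<close> unless
    \<open>w = 0\<close>.\<close>
  have gt: "g (v + t *\<^sub>R w) = t^2 * g w - 2 * t * (w \<bullet> w)" for t
  proof -
    have Avw: "v \<bullet> (A *v w) = w \<bullet> (A *v v)"
      using symmetric_inner[OF sym, of v w] by (simp add: inner_commute)
    have ww: "w \<bullet> w = w \<bullet> (A *v v) - l * (w \<bullet> v)"
      by (subst (2) w_def) (simp add: inner_diff_right)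
    show ?thesis
      unfolding g_def
      by (simp add: ww matrix_vector_right_distrib matrix_vector_mult_scaleR inner_add_left inner_add_right Avw
          vv l_def[symmetric] inner_commute[of v w])
        (simp add: algebra_simps power2_eq_square)
  qed
  have ineq: "2 * t * (w \<bullet> w) \<le> t^2 * g w" for t
    using g_nonneg[of "v + t *\<^sub>R w"] gt[of t] S(1) vS wS by (simp add: subspace_add subspace_scale)
  have "w \<bullet> w = 0"
  proof (rule ccontr)
    assume "w \<bullet> w \<noteq> 0"
    then have pos: "w \<bullet> w > 0" by simp
    \<comment> \<open>The \<open>1\<close> keeps the denominator positive when
      \<open>g w = 0\<close>, and still leaves \<open>t * g w \<le> w \<bullet> w\<close>.\<close>
    define t where "t = (w \<bullet> w) / (g w + 1)"
    have gw: "g w \<ge> 0" using g_nonneg wS by blast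
    have t: "t > 0" using pos gw by (simp add: t_def)
    have "2 * (w \<bullet> w) \<le> t * g w"
      using ineq[of t] t by (simp add: power2_eq_square)
    moreover have "t * g w \<le> w \<bullet> w"
      using gw pos by (simp add: t_def divide_le_eq distrib_left)
    ultimately show False using pos by linarith
  qed
  then have "A *v v = l *\<^sub>R v"
    by (simp add: w_def)
  then show ?thesis
    using vS v(1) by auto
qed

text \<open>Induction on the dimension: split off one unit eigenvector \<open>v\<close>. By symmetry
  of \<open>A\<close> its orthogonal complement \<open>T\<close> within \<open>S\<close> is again
  invariant, and it is smaller because it omits \<open>v\<close>.\<close>

lemma symmetric_eigenbasis_subspace:
  fixes A :: "real ^ 'n::finite ^ 'n"
  assumes sym: "transpose A = A"
  shows "subspace S \<Longrightarrow> (\<And>x. x \<in> S \<Longrightarrow> A *v x \<in> S) \<Longrightarrow>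
    \<exists>B. finite B \<and> pairwise orthogonal B \<and> (\<forall>v\<in>B. norm v = 1 \<and> (\<exists>l. A *v v = l *\<^sub>R v)) \<and> span B = S"
proof (induction "dim S" arbitrary: S rule: less_induct)
  case less
  show ?case
  proof (cases "S = {0}")
    case True
    then show ?thesis
      by (intro exI[of _ "{}"]) simp
  next
    case False
    obtain v l where v: "v \<in> S" "norm v = 1" "A *v v = l *\<^sub>R v"
      using symmetric_eigenvector_in_subspace[OF sym less.prems False] by blast
    define T where "T = {u \<in> S. v \<bullet> u = 0}"
    have vv: "v \<bullet> v = 1" using v(2) by (simp add: dot_square_norm)
    have T: "subspace T"
      using less.prems(1) by (auto simp: T_def subspace_def inner_add_right)
    have "v \<notin> T" by (simp add: T_def vv)
    then have "T \<subset> S" using v(1) unfolding T_def by blast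
    then have "dim T < dim S"
      using T less.prems(1) by (intro dim_psubset) (simp add: span_eq_iff[THEN iffD2])
    moreover have "A *v x \<in> T" if "x \<in> T" for x
      using that less.prems(2) symmetric_inner[OF sym, of v x] v(3) by (auto simp: T_def)
    ultimately obtain B where B: "finite B" "pairwise orthogonal B"
      "\<forall>v\<in>B. norm v = 1 \<and> (\<exists>l. A *v v = l *\<^sub>R v)" "span B = T"
      using less.hyps[of T] T by blast
    have "u \<in> span (insert v B)" if "u \<in> S" for u
    proof -
      have "u - (v \<bullet> u) *\<^sub>R v \<in> span B"
        using that less.prems(1) v(1)
        by (simp add: B(4) T_def subspace_diff subspace_scale inner_diff_right vv)
      then show ?thesis
        by (auto simp: span_insert)
    qed
    moreover have "span (insert v B) \<subseteq> S"
      using B(4) v(1) less.prems(1) span_superset[of B] by (intro span_minimal) (auto simp: T_def)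
    ultimately have "span (insert v B) = S" by blast
    moreover have "pairwise orthogonal (insert v B)"
      using B(2) B(4) span_superset[of B]
      by (auto simp: pairwise_insert orthogonal_def T_def inner_commute)
    ultimately show ?thesis
      using B v by (intro exI[of _ "insert v B"]) auto
  qed
qed

lemma symmetric_eigenbasis:
  fixes A :: "real ^ 'n::finite ^ 'n"
  assumes sym: "transpose A = A"
  shows "\<exists>b l. orthonormal b \<and> (\<forall>i. A *v b i = l i *\<^sub>R b i)"
proof -
  obtain B where B: "finite B" "pairwise orthogonal B"
      "\<forall>v\<in>B. norm v = 1 \<and> (\<exists>l. A *v v = l *\<^sub>R v)" "span B = (UNIV :: (real ^ 'n) set)"
    using symmetric_eigenbasis_subspace[OF sym, of UNIV] by auto
  have "independent B"
    using B(2,3) by (intro pairwise_orthogonal_independent) auto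
  then have "card B = CARD('n)"
    using B(4) dim_eq_card[of B UNIV] by simp
  then obtain b where b: "bij_betw b (UNIV :: 'n set) B"
    using B(1) finite_same_card_bij[of "UNIV :: 'n set" B] by auto
  have bB: "b i \<in> B" for i
    using b by (auto simp: bij_betw_def)
  have "orthonormal b"
    unfolding orthonormal_def
  proof (intro allI)
    fix i j
    show "b i \<bullet> b j = (if i = j then 1 else 0)"
      using bB[of i] bB[of j] B(2,3) inj_eq[OF bij_betw_imp_inj_on[OF b], of i j]
      by (cases "i = j") (simp_all add: pairwise_def orthogonal_def dot_square_norm)
  qed
  moreover have "\<forall>i. \<exists>l. A *v b i = l *\<^sub>R b i"
    using bB B(3) by blast
  then have "\<exists>l. \<forall>i. A *v b i = l i *\<^sub>R b i"
    by (rule choice)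
  ultimately show ?thesis by blast
qed

section \<open>Relative entropy and measurements\<close>

text \<open>The right-hand side is the maximum of the left-hand side over \<open>z\<close>, found by
  completing the square. If \<open>x + t * y = 0\<close>, then \<open>x\<close> and \<open>y\<close>
  both vanish, so the convention for division by zero does no harm.\<close>

lemma quadratic_le_div:
  fixes x y t c z :: real
  assumes "x \<ge> 0" "y \<ge> 0" "t > 0"
  shows "2 * z * c * y - x * z^2 - t * y * z^2 \<le> c^2 * y^2 / (x + t * y)"
proof (cases "x + t * y = 0")
  case True
  then have "x = 0" "y = 0"
    using assms by (auto simp: add_nonneg_eq_0_iff)
  then show ?thesis by simp
next
  case False
  then have pos: "x + t * y > 0"
    using assms by (simp add: less_le)
  have "0 \<le> (c * y - (x + t * y) * z)^2"
    by simp
  then have "(2 * z * c * y - x * z^2 - t * y * z^2) * (x + t * y) \<le> c^2 * y^2"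
    by (simp add: algebra_simps power2_eq_square)
  then show ?thesis
    using pos by (simp add: le_divide_eq)
qed

text \<open>With \<open>Z = \<Sum>\<^sub>k z\<^sub>k v\<^sub>k v\<^sub>k\<^sup>T\<close>, both sides
  are the squared norm of \<open>Z u\<close>, computed in the basis \<open>b\<close> and in the
  basis \<open>v\<close>.\<close>

lemma sum_sq_test_matrix:
  fixes v b :: "'n::finite \<Rightarrow> real ^ 'n"
  assumes v: "orthonormal v" and b: "orthonormal b"
  shows "(\<Sum>i\<in>UNIV. (\<Sum>k\<in>UNIV. z k * (b i \<bullet> v k) * (v k \<bullet> u))^2) = (\<Sum>k\<in>UNIV. z k^2 * (v k \<bullet> u)^2)"
proof -
  define Zu where "Zu = (\<Sum>k\<in>UNIV. (z k * (v k \<bullet> u)) *\<^sub>R v k)"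
  have "(\<Sum>i\<in>UNIV. (\<Sum>k\<in>UNIV. z k * (b i \<bullet> v k) * (v k \<bullet> u))^2) = (\<Sum>i\<in>UNIV. (b i \<bullet> Zu) * (b i \<bullet> Zu))"
    by (simp add: Zu_def inner_sum_right power2_eq_square mult_ac)
  also have "\<dots> = Zu \<bullet> Zu"
    by (rule orthonormal_parseval[OF b])
  also have "\<dots> = (\<Sum>k\<in>UNIV. (v k \<bullet> Zu) * (v k \<bullet> Zu))"
    by (rule orthonormal_parseval[OF v, symmetric])
  also have "\<dots> = (\<Sum>k\<in>UNIV. z k^2 * (v k \<bullet> u)^2)"
  proof -
    have vv: "v k \<bullet> v l = (if k = l then 1 else 0)" for k l
      using v by (simp add: orthonormal_def)
    have "v k \<bullet> Zu = z k * (v k \<bullet> u)" for k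
      by (simp add: Zu_def inner_sum_right vv if_distrib cong: if_cong)
    then show ?thesis
      by (simp add: power2_eq_square mult_ac)
  qed
  finally show ?thesis .
qed

text \<open>For the same \<open>Z\<close>, and for \<open>Y\<close> and \<open>X\<close> diagonal in
  \<open>a\<close> and \<open>b\<close> with eigenvalues \<open>y\<close> and \<open>x\<close>, the
  left-hand side is \<open>2 tr (Z Y) - tr (Z\<^sup>2 X) - t tr (Z\<^sup>2 Y)\<close>. Written in
  the entries of \<open>Z\<close> between \<open>a\<close> and \<open>b\<close>, it splits into
  separate quadratics, each bounded by \<open>quadratic_le_div\<close>. The numbers
  \<open>p k\<close> and \<open>q k\<close> are the weights of \<open>Y\<close> and \<open>X\<close>
  measured in \<open>v\<close>.\<close>

lemma measured_chi_square_le: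
  fixes a b v :: "'n::finite \<Rightarrow> real ^ 'n" and x y z :: "'n \<Rightarrow> real"
  assumes a: "orthonormal a" and b: "orthonormal b" and v: "orthonormal v"
    and x: "\<And>j. x j \<ge> 0" and y: "\<And>i. y i \<ge> 0" and t: "t > 0"
  defines "p \<equiv> \<lambda>k. \<Sum>i\<in>UNIV. y i * (a i \<bullet> v k)^2"
    and "q \<equiv> \<lambda>k. \<Sum>j\<in>UNIV. x j * (b j \<bullet> v k)^2"
  shows "(\<Sum>k\<in>UNIV. 2 * z k * p k - z k^2 * q k - t * z k^2 * p k)
    \<le> (\<Sum>i\<in>UNIV. \<Sum>j\<in>UNIV. (a i \<bullet> b j)^2 * y i^2 / (x j + t * y i))"
proof -
  define Z where "Z i j = (\<Sum>k\<in>UNIV. z k * (a i \<bullet> v k) * (v k \<bullet> b j))" for i j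
  have 1: "(\<Sum>i\<in>UNIV. \<Sum>j\<in>UNIV. Z i j * (a i \<bullet> b j) * y i) = (\<Sum>k\<in>UNIV. z k * p k)"
  proof -
    have "(\<Sum>j\<in>UNIV. Z i j * (a i \<bullet> b j)) = (\<Sum>k\<in>UNIV. z k * (a i \<bullet> v k)^2)" for i
    proof -
      have "(\<Sum>j\<in>UNIV. Z i j * (a i \<bullet> b j))
          = (\<Sum>k\<in>UNIV. z k * (a i \<bullet> v k) * (\<Sum>j\<in>UNIV. (b j \<bullet> v k) * (b j \<bullet> a i)))"
        unfolding Z_def sum_distrib_left sum_distrib_right
        by (subst sum.swap) (simp add: mult_ac inner_commute)
      also have "\<dots> = (\<Sum>k\<in>UNIV. z k * (a i \<bullet> v k)^2)"
        by (subst orthonormal_parseval[OF b]) (simp add: power2_eq_square inner_commute mult_ac)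
      finally show ?thesis .
    qed
    then have "(\<Sum>i\<in>UNIV. \<Sum>j\<in>UNIV. Z i j * (a i \<bullet> b j) * y i) = (\<Sum>i\<in>UNIV. \<Sum>k\<in>UNIV. z k * (a i \<bullet> v k)^2 * y i)"
      by (simp flip: sum_distrib_right)
    also have "\<dots> = (\<Sum>k\<in>UNIV. z k * p k)"
      unfolding p_def sum_distrib_left by (subst sum.swap) (simp add: mult_ac)
    finally show ?thesis .
  qed
  have 2: "(\<Sum>i\<in>UNIV. \<Sum>j\<in>UNIV. x j * Z i j^2) = (\<Sum>k\<in>UNIV. z k^2 * q k)"
  proof -
    have "(\<Sum>i\<in>UNIV. \<Sum>j\<in>UNIV. x j * Z i j^2) = (\<Sum>j\<in>UNIV. x j * (\<Sum>i\<in>UNIV. Z i j^2))"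
      by (subst sum.swap) (simp add: sum_distrib_left)
    also have "\<dots> = (\<Sum>j\<in>UNIV. \<Sum>k\<in>UNIV. x j * (z k^2 * (v k \<bullet> b j)^2))"
      unfolding Z_def sum_sq_test_matrix[OF v a] by (simp add: sum_distrib_left)
    also have "\<dots> = (\<Sum>k\<in>UNIV. z k^2 * q k)"
      unfolding q_def sum_distrib_left by (subst sum.swap) (simp add: mult_ac inner_commute)
    finally show ?thesis .
  qed
  have 3: "(\<Sum>i\<in>UNIV. \<Sum>j\<in>UNIV. t * y i * Z i j^2) = (\<Sum>k\<in>UNIV. t * z k^2 * p k)"
  proof -
    have "(\<Sum>i\<in>UNIV. \<Sum>j\<in>UNIV. t * y i * Z i j^2) = (\<Sum>i\<in>UNIV. t * y i * (\<Sum>j\<in>UNIV. Z i j^2))"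
      by (simp add: sum_distrib_left)
    also have "\<dots> = (\<Sum>i\<in>UNIV. \<Sum>k\<in>UNIV. t * y i * (z k^2 * (v k \<bullet> a i)^2))"
      using sum_sq_test_matrix[OF v b, where z = z]
      unfolding Z_def by (simp add: sum_distrib_left inner_commute mult_ac)
    also have "\<dots> = (\<Sum>k\<in>UNIV. t * z k^2 * p k)"
      unfolding p_def sum_distrib_left by (subst sum.swap) (simp add: mult_ac inner_commute)
    finally show ?thesis .
  qed
  have "(\<Sum>k\<in>UNIV. 2 * z k * p k - z k^2 * q k - t * z k^2 * p k)
      = 2 * (\<Sum>k\<in>UNIV. z k * p k) - (\<Sum>k\<in>UNIV. z k^2 * q k) - (\<Sum>k\<in>UNIV. t * z k^2 * p k)"
    by (simp add: sum_subtractf sum_distrib_left mult_ac)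
  also have "\<dots> = (\<Sum>i\<in>UNIV. \<Sum>j\<in>UNIV. 2 * Z i j * (a i \<bullet> b j) * y i - x j * Z i j^2 - t * y i * Z i j^2)"
    unfolding 1[symmetric] 2[symmetric] 3[symmetric]
    by (simp add: sum_subtractf sum_distrib_left mult_ac)
  also have "\<dots> \<le> (\<Sum>i\<in>UNIV. \<Sum>j\<in>UNIV. (a i \<bullet> b j)^2 * y i^2 / (x j + t * y i))"
    using x y t by (intro sum_mono quadratic_le_div) auto
  finally show ?thesis .
qed

text \<open>
  With \<open>Y = \<Sum>\<^sub>i y\<^sub>i a\<^sub>i a\<^sub>i\<^sup>T\<close> and \<open>X = \<Sum>\<^sub>j x\<^sub>j b\<^sub>j b\<^sub>j\<^sup>T\<close>, the left-hand side is the Umegaki relative entropy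
  of \<open>Y\<close> with respect to \<open>X\<close>; hypothesis \<open>ac\<close> says that the kernel of \<open>X\<close> is contained in that
  of \<open>Y\<close>.  The proof integrates the \<open>\<chi>\<^sup>2\<close>-type bound above over \<open>t\<close>, since
  \<open>ln (x/y + T) - ln (x/y)\<close> is the integral of \<open>y / (x + t y)\<close> over \<open>[0, T]\<close>; the choice
  \<open>z\<^sub>k = 1 / (exp (- m\<^sub>k) + t)\<close> is the optimal one for \<open>q\<^sub>k = exp (- m\<^sub>k) p\<^sub>k\<close>.
\<close>

lemma relative_entropy_ge_measured:
  fixes a b v :: "'n::finite \<Rightarrow> real ^ 'n" and x y m :: "'n \<Rightarrow> real"
  assumes a: "orthonormal a" and b: "orthonormal b" and v: "orthonormal v"
    and x: "\<And>j. x j \<ge> 0" and y: "\<And>i. y i \<ge> 0"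
    and ac: "\<And>i j. x j = 0 \<Longrightarrow> y i * (a i \<bullet> b j)^2 = 0"
  defines "p \<equiv> \<lambda>k. \<Sum>i\<in>UNIV. y i * (a i \<bullet> v k)^2"
    and "q \<equiv> \<lambda>k. \<Sum>j\<in>UNIV. x j * (b j \<bullet> v k)^2"
  shows "(\<Sum>i\<in>UNIV. \<Sum>j\<in>UNIV. y i * (a i \<bullet> b j)^2 * (ln (y i) - ln (x j)))
    \<ge> (\<Sum>k\<in>UNIV. p k * m k + p k - q k * exp (m k))"
proof -
  define w where "w i j = y i * (a i \<bullet> b j)^2" for i j
  define s where "s k = exp (- m k)" for k
  have s: "s k > 0" for k by (simp add: s_def)
  \<comment> \<open>By \<open>ac\<close>, each term has zero weight or positive arguments in both
    logarithms, so the value of \<open>ln 0\<close> never matters.\<close>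
  have pos: "w i j = 0 \<or> (y i > 0 \<and> x j > 0)" for i j
    using ac[of j i] x[of j] y[of i] by (auto simp: w_def less_le)
  \<comment> \<open>\<open>f\<close> and \<open>g\<close> are antiderivatives in \<open>t\<close> of
    the terms on the two sides of \<open>measured_chi_square_le\<close>. Hence \<open>D\<close> is
    nondecreasing; as it tends to 0 at infinity, \<open>D 0 \<le> 0\<close>, which is the
    claim.\<close>
  define f where "f i j t = w i j * ln (x j / y i + t)" for i j t
  define g where "g k t = p k * ln (s k + t) - (p k * s k - q k) / (s k + t)" for k t
  define D where "D t = (\<Sum>i\<in>UNIV. \<Sum>j\<in>UNIV. f i j t) - (\<Sum>k\<in>UNIV. g k t)" for t
  have df: "(f i j has_real_derivative (w i j * y i / (x j + t * y i))) (at t)" if "t \<ge> 0" for i j t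
  proof (cases "w i j = 0")
    case True
    then have "f i j = (\<lambda>t. 0)" by (auto simp: f_def)
    then show ?thesis using True by simp
  next
    case False
    with pos have p: "y i > 0" "x j > 0" by blast+
    then have "x j / y i + t > 0" using that by (simp add: add_pos_nonneg)
    then have "(f i j has_real_derivative (w i j * (1 / (x j / y i + t)))) (at t)"
      unfolding f_def by (auto intro!: derivative_eq_intros)
    moreover have "1 / (x j / y i + t) = y i / (x j + t * y i)"
      using p by (simp add: field_simps)
    ultimately show ?thesis by simp
  qed
  have dg: "(g k has_real_derivative
      (2 * (1 / (s k + t)) * p k - (1 / (s k + t))^2 * q k - t * (1 / (s k + t))^2 * p k)) (at t)"
    if "t \<ge> 0" for k t
  proof -
    have pos: "s k + t > 0" using s[of k] that by linarith
    have "(g k has_real_derivative (p k * (1 / (s k + t)) + (p k * s k - q k) / (s k + t)^2)) (at t)"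
      unfolding g_def using pos
      by (auto intro!: derivative_eq_intros simp: power2_eq_square add_divide_distrib diff_divide_distrib)
    moreover have "p k * (1 / (s k + t)) + (p k * s k - q k) / (s k + t)^2 =
        2 * (1 / (s k + t)) * p k - (1 / (s k + t))^2 * q k - t * (1 / (s k + t))^2 * p k"
      using pos by (simp add: divide_simps power2_eq_square) (simp add: algebra_simps)
    ultimately show ?thesis by simp
  qed
  have dD: "\<exists>d. (D has_real_derivative d) (at t) \<and> d \<ge> 0" if "t > 0" for t
  proof (intro exI conjI)
    show "(D has_real_derivative ((\<Sum>i\<in>UNIV. \<Sum>j\<in>UNIV. w i j * y i / (x j + t * y i)) -
      (\<Sum>k\<in>UNIV. 2 * (1 / (s k + t)) * p k - (1 / (s k + t))^2 * q k - t * (1 / (s k + t))^2 * p k))) (at t)"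
      unfolding D_def using that by (intro DERIV_diff DERIV_sum df dg) auto
    show "(\<Sum>i\<in>UNIV. \<Sum>j\<in>UNIV. w i j * y i / (x j + t * y i)) -
      (\<Sum>k\<in>UNIV. 2 * (1 / (s k + t)) * p k - (1 / (s k + t))^2 * q k - t * (1 / (s k + t))^2 * p k) \<ge> 0"
      using measured_chi_square_le[OF a b v x y that, where z = "\<lambda>k. 1 / (s k + t)"]
      by (simp add: p_def q_def w_def power2_eq_square mult_ac)
  qed
  have cont: "continuous_on {0..T} D" for T
  proof -
    have "continuous_on {0..T} (f i j)" for i j
      by (rule DERIV_continuous_on[OF has_field_derivative_at_within[OF df]]) simp
    moreover have "continuous_on {0..T} (g k)" for k
      by (rule DERIV_continuous_on[OF has_field_derivative_at_within[OF dg]]) simp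
    ultimately show ?thesis
      unfolding D_def by (intro continuous_on_diff continuous_on_sum)
  qed
  have mono: "D 0 \<le> D T" if "T > 0" for T
    using that dD by (intro DERIV_nonneg_imp_increasing_open[of 0 T D]) (auto intro: cont)
  \<comment> \<open>Both sums equal the trace of \<open>Y\<close>: squared overlaps with an
    orthonormal basis sum to 1.\<close>
  have wsum: "(\<Sum>i\<in>UNIV. \<Sum>j\<in>UNIV. w i j) = (\<Sum>k\<in>UNIV. p k)"
  proof -
    have "(\<Sum>j\<in>UNIV. (a i \<bullet> c j)^2) = 1" if "orthonormal c" for c :: "'n \<Rightarrow> real ^ 'n" and i
      using orthonormal_parseval[OF that, of "a i" "a i"] a
      by (simp add: orthonormal_def power2_eq_square inner_commute)
    then show ?thesis
      unfolding p_def w_def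
      by (subst (2) sum.swap) (simp add: b v flip: sum_distrib_left)
  qed
  \<comment> \<open>Equal total weights allow \<open>ln t\<close> to be subtracted from every
    logarithm, after which each summand tends to 0 separately.\<close>
  have Dalt: "D t = (\<Sum>i\<in>UNIV. \<Sum>j\<in>UNIV. w i j * (ln (x j / y i + t) - ln t)) -
      (\<Sum>k\<in>UNIV. p k * (ln (s k + t) - ln t) - (p k * s k - q k) / (s k + t))" for t
  proof -
    have "(\<Sum>i\<in>UNIV. \<Sum>j\<in>UNIV. w i j * ln t) = (\<Sum>k\<in>UNIV. p k * ln t)"
      using wsum by (simp flip: sum_distrib_right)
    then show ?thesis
      by (simp add: D_def f_def g_def right_diff_distrib sum_subtractf)
  qed
  have ln_lim: "((\<lambda>t. ln (c + t) - ln t) \<longlongrightarrow> 0) at_top" for c :: real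
    by real_asymp
  have div_lim: "((\<lambda>t. c / (d + t)) \<longlongrightarrow> 0) at_top" for c d :: real
    by real_asymp
  have "(D \<longlongrightarrow> (\<Sum>i\<in>UNIV. \<Sum>j\<in>UNIV. w i j * 0) - (\<Sum>k\<in>UNIV. p k * 0 - 0)) at_top"
    unfolding Dalt by (intro tendsto_intros ln_lim div_lim)
  then have "(D \<longlongrightarrow> 0) at_top" by simp
  then have D0: "D 0 \<le> 0"
    by (rule tendsto_lowerbound) (auto intro: eventually_mono[OF eventually_gt_at_top[of 0]] mono)
  have "f i j 0 = - (w i j * (ln (y i) - ln (x j)))" for i j
    using pos[of i j] by (auto simp: f_def ln_div algebra_simps)
  moreover have "g k 0 = - (p k * m k + p k - q k * exp (m k))" for k
    by (simp add: g_def s_def) (simp add: exp_minus field_simps)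
  ultimately have "D 0 = (\<Sum>k\<in>UNIV. p k * m k + p k - q k * exp (m k))
      - (\<Sum>i\<in>UNIV. \<Sum>j\<in>UNIV. w i j * (ln (y i) - ln (x j)))"
    unfolding D_def by (simp only: sum_negf)
  then show ?thesis
    using D0 by (simp add: w_def)
qed

text \<open>The quotient \<open>g\<close> of the two sides decreases to \<open>g 0 = 1\<close>,
  increases up to \<open>z = 1\<close> and decreases afterwards, so only the end point
  \<open>3/2\<close> needs a numerical check. The range of this inequality is the source of the
  condition \<open>\<eta> * R \<le> 3/2\<close>, and thereby of the constant 2/3 in the final
  bound.\<close>

lemma exp_le_quadratic:
  fixes z :: real
  assumes "z \<le> 3/2"
  shows "exp z \<le> 1 + z + z^2"
proof -
  define g :: "real \<Rightarrow> real" where "g z = exp (-z) * (1 + z + z^2)" for z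
  have dg: "(g has_real_derivative (exp (-z) * (z * (1 - z)))) (at z)" for z
    unfolding g_def by (auto intro!: derivative_eq_intros simp: algebra_simps power2_eq_square)
  have inc: "g u \<le> g v" if "u \<le> v" "0 \<le> u" "v \<le> 1" for u v
  proof (rule DERIV_nonneg_imp_nondecreasing[OF that(1)])
    fix w assume "u \<le> w" "w \<le> v"
    then show "\<exists>d. (g has_real_derivative d) (at w) \<and> d \<ge> 0"
      using that by (intro exI[of _ "exp (-w) * (w * (1 - w))"] conjI dg) simp
  qed
  have dec: "g v \<le> g u" if "u \<le> v" "v \<le> 0 \<or> 1 \<le> u" for u v
  proof (rule DERIV_nonpos_imp_nonincreasing[OF that(1)])
    fix w assume w: "u \<le> w" "w \<le> v"
    then have "w * (1 - w) \<le> 0"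
      using that(2) by (auto simp: mult_le_0_iff)
    then show "\<exists>d. (g has_real_derivative d) (at w) \<and> d \<le> 0"
      by (intro exI[of _ "exp (-w) * (w * (1 - w))"] conjI dg) (simp add: mult_nonneg_nonpos)
  qed
  have "g z \<ge> 1"
  proof (cases "z \<le> 1")
    case True
    then have "g 0 \<le> g z"
      using inc[of 0 z] dec[of z 0] by linarith
    then show ?thesis by (simp add: g_def)
  next
    case False
    then have "g (3/2) \<le> g z"
      using assms by (intro dec) auto
    \<comment> \<open>\<open>19/4\<close> is the value of \<open>1 + z + z^2\<close> at
      \<open>z = 3/2\<close>; squaring reduces the estimate to a bound on
      \<open>exp 1\<close>.\<close>
    moreover have "exp (3/2::real) \<le> 19/4"
    proof (rule power2_le_imp_le)
      have "exp (3/2::real)^2 = exp 1 ^ 3"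
        by (simp flip: exp_of_nat_mult)
      also have "\<dots> \<le> (272/100)^3"
        using e_less_272 by (intro power_mono) auto
      also have "\<dots> \<le> (19/4)^2"
        by (simp add: power2_eq_square power3_eq_cube)
      finally show "exp (3/2::real)^2 \<le> (19/4)^2" .
    qed simp
    then have "g (3/2) \<ge> 1"
      by (simp add: g_def exp_minus power2_eq_square field_simps)
    ultimately show ?thesis by linarith
  qed
  then show ?thesis
    by (simp add: g_def exp_minus field_simps)
qed

section \<open>Eigenbases, density matrices and von Neumann entropy\<close>

definition eigvec :: "real ^ 'n::finite ^ 'n \<Rightarrow> 'n \<Rightarrow> real ^ 'n" where
  "eigvec A = (SOME b. orthonormal b \<and> (\<exists>l. \<forall>i. A *v b i = l i *\<^sub>R b i))"

text \<open>As a Rayleigh quotient the eigenvalue needs no second choice, and its nonnegativity for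
  positive semidefinite \<open>A\<close> is immediate.\<close>

definition eigval :: "real ^ 'n::finite ^ 'n \<Rightarrow> 'n \<Rightarrow> real" where
  "eigval A i = eigvec A i \<bullet> (A *v eigvec A i)"

lemma
  fixes A :: "real ^ 'n::finite ^ 'n"
  assumes "transpose A = A"
  shows orthonormal_eigvec: "orthonormal (eigvec A)"
    and eigvec_eigval: "A *v eigvec A i = eigval A i *\<^sub>R eigvec A i"
proof -
  have *: "orthonormal (eigvec A) \<and> (\<exists>l. \<forall>i. A *v eigvec A i = l i *\<^sub>R eigvec A i)"
    unfolding eigvec_def using someI_ex[OF symmetric_eigenbasis[OF assms, unfolded ex_simps]] by simp
  then show o: "orthonormal (eigvec A)" by blast
  obtain l where l: "\<And>i. A *v eigvec A i = l i *\<^sub>R eigvec A i"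
    using * by blast
  have "eigval A i = l i"
    using o by (simp add: eigval_def l orthonormal_def)
  then show "A *v eigvec A i = eigval A i *\<^sub>R eigvec A i"
    using l by simp
qed

lemma quadratic_form_eigen:
  fixes A :: "real ^ 'n::finite ^ 'n"
  assumes A: "transpose A = A"
  shows "u \<bullet> (A *v u) = (\<Sum>i\<in>UNIV. eigval A i * (eigvec A i \<bullet> u)^2)"
proof -
  have "u \<bullet> (A *v u) = (\<Sum>i\<in>UNIV. (eigvec A i \<bullet> u) * (eigvec A i \<bullet> (A *v u)))"
    by (rule orthonormal_parseval[OF orthonormal_eigvec[OF A], symmetric])
  also have "\<dots> = (\<Sum>i\<in>UNIV. eigval A i * (eigvec A i \<bullet> u)^2)"
    by (simp add: symmetric_inner[OF A, symmetric] eigvec_eigval[OF A] power2_eq_square mult_ac)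
  finally show ?thesis .
qed

lemma inner_matrix_eigen:
  fixes A X :: "real ^ 'n::finite ^ 'n"
  assumes A: "transpose A = A"
  shows "A \<bullet> X = (\<Sum>i\<in>UNIV. eigval A i * (eigvec A i \<bullet> (X *v eigvec A i)))"
  by (simp add: inner_matrix_orthonormal[OF orthonormal_eigvec[OF A]] eigvec_eigval[OF A])

lemma inner_square_eigen:
  fixes A X :: "real ^ 'n::finite ^ 'n"
  assumes A: "transpose A = A"
  shows "(A ** A) \<bullet> X = (\<Sum>i\<in>UNIV. eigval A i ^ 2 * (eigvec A i \<bullet> (X *v eigvec A i)))"
  by (simp add: inner_matrix_orthonormal[OF orthonormal_eigvec[OF A]] eigvec_eigval[OF A]
      matrix_vector_mul_assoc[symmetric] matrix_vector_mult_scaleR power2_eq_square)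

lemma abs_eigval_le:
  fixes A :: "real ^ 'n::finite ^ 'n"
  assumes A: "transpose A = A"
  shows "\<bar>eigval A i\<bar> \<le> spectral_norm A"
proof -
  have n: "norm (eigvec A i) = 1"
    using orthonormal_eigvec[OF A] by (simp add: orthonormal_def norm_eq_1)
  have "norm (A *v eigvec A i) \<le> spectral_norm A * norm (eigvec A i)"
    by (rule onorm[OF matrix_vector_mul_bounded_linear])
  then show ?thesis
    by (simp add: eigvec_eigval[OF A] n)
qed

definition density :: "real ^ 'n::finite ^ 'n \<Rightarrow> bool" where
  "density X \<longleftrightarrow> transpose X = X \<and> (\<forall>u. 0 \<le> u \<bullet> (X *v u)) \<and> trace X = 1"

lemma eigval_density:
  assumes "density X"
  shows "eigval X i \<ge> 0" "(\<Sum>i\<in>UNIV. eigval X i) = 1" "eigval X i \<le> 1"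
proof -
  show nonneg: "eigval X i \<ge> 0" for i
    using assms by (simp add: density_def eigval_def)
  show one: "(\<Sum>i\<in>UNIV. eigval X i) = 1"
    using assms trace_orthonormal[OF orthonormal_eigvec, of X X] by (simp add: density_def eigval_def)
  then show "eigval X i \<le> 1"
    using member_le_sum[of i UNIV "eigval X"] nonneg by simp
qed

lemma density_orthonormal_weights:
  assumes "density X" "orthonormal v"
  shows "v i \<bullet> (X *v v i) \<ge> 0" "(\<Sum>i\<in>UNIV. v i \<bullet> (X *v v i)) = 1"
  using assms trace_orthonormal[of v X] by (simp_all add: density_def)

definition neg_entropy :: "real ^ 'n::finite ^ 'n \<Rightarrow> real" where
  "neg_entropy X = (\<Sum>i\<in>UNIV. eigval X i * ln (eigval X i))"

text \<open>The trace of \<open>Y log X\<close>, with the junk value \<open>log 0 = 0\<close> on the kernel of \<open>X\<close>.\<close>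

definition cross_log :: "real ^ 'n::finite ^ 'n \<Rightarrow> real ^ 'n ^ 'n \<Rightarrow> real" where
  "cross_log Y X = (\<Sum>j\<in>UNIV. (eigvec X j \<bullet> (Y *v eigvec X j)) * ln (eigval X j))"

lemma cross_log_self: "cross_log X X = neg_entropy X"
  by (simp add: cross_log_def neg_entropy_def eigval_def)

lemma cross_log_add: "cross_log (Y + Z) X = cross_log Y X + cross_log Z X"
  by (simp add: cross_log_def matrix_vector_mult_add_rdistrib inner_add_right distrib_right sum.distrib)

lemma cross_log_scaleR: "cross_log (c *\<^sub>R Y) X = c * cross_log Y X"
  by (simp add: cross_log_def sum_distrib_left mult_ac flip: scaleR_matrix_vector_assoc)

lemma neg_entropy_nonpos:
  assumes "density X"
  shows "neg_entropy X \<le> 0"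
  unfolding neg_entropy_def
proof (rule sum_nonpos)
  fix i
  show "eigval X i * ln (eigval X i) \<le> 0"
  proof (cases "eigval X i = 0")
    case False
    then have "eigval X i > 0"
      using eigval_density(1)[OF assms, of i] by linarith
    then have "ln (eigval X i) \<le> 0"
      using eigval_density(3)[OF assms, of i] by simp
    then show ?thesis
      using eigval_density(1)[OF assms, of i] by (rule mult_nonneg_nonpos[rotated])
  qed simp
qed

text \<open>Nonnegativity of the relative entropy of the eigenvalue distribution with respect to the
  uniform one, obtained termwise from \<open>ln s \<le> s - 1\<close>.\<close>

lemma neg_entropy_ge:
  fixes X :: "real ^ 'n::finite ^ 'n"
  assumes "density X"
  shows "neg_entropy X \<ge> - ln (real CARD('n))"
proof -
  let ?N = "real CARD('n)"
  have N: "?N > 0" by simp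
  have "eigval X i * ln (eigval X i) \<ge> eigval X i - 1 / ?N - eigval X i * ln ?N" for i
  proof (cases "eigval X i = 0")
    case False
    then have x: "eigval X i > 0"
      using eigval_density(1)[OF assms, of i] by simp
    then have "ln (1 / (eigval X i * ?N)) \<le> 1 / (eigval X i * ?N) - 1"
      using N by (intro ln_le_minus_one) simp
    then have "- ln (eigval X i) - ln ?N \<le> 1 / (eigval X i * ?N) - 1"
      using x N by (simp add: ln_div ln_mult)
    then have "eigval X i * (- ln (eigval X i) - ln ?N) \<le> eigval X i * (1 / (eigval X i * ?N) - 1)"
      using x by (intro mult_left_mono) auto
    also have "\<dots> = 1 / ?N - eigval X i"
      using x by (simp add: field_simps)
    finally show ?thesis by (simp add: algebra_simps)
  qed simp
  then have "neg_entropy X \<ge> (\<Sum>i\<in>UNIV. eigval X i - 1 / ?N - eigval X i * ln ?N)"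
    unfolding neg_entropy_def by (intro sum_mono)
  also have "(\<Sum>i\<in>UNIV. eigval X i - 1 / ?N - eigval X i * ln ?N) = - ln ?N"
    using eigval_density(2)[OF assms] by (simp add: sum_subtractf flip: sum_distrib_right)
  finally show ?thesis .
qed

text \<open>Measuring in the eigenbasis of \<open>M\<close>, with
  \<open>m k = \<eta> * eigval M k\<close>, gives a lower bound containing
  \<open>exp (\<eta> * eigval M k)\<close>. The quadratic bound on \<open>exp\<close> turns it into
  matrix inner products, and the constants cancel because \<open>X\<close> and \<open>Y\<close> both
  have trace 1. Hypothesis \<open>ker\<close> makes the left-hand side the true relative entropy in
  spite of the junk logarithm in \<open>cross_log\<close>.\<close>

lemma relative_entropy_ge_quadratic:
  fixes X Y M :: "real ^ 'n::finite ^ 'n"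
  assumes X: "density X" and Y: "density Y" and M: "transpose M = M"
    and ker: "\<And>u. u \<bullet> (X *v u) = 0 \<Longrightarrow> u \<bullet> (Y *v u) = 0"
    and small: "\<And>k. \<eta> * eigval M k \<le> 3/2"
  shows "neg_entropy Y - cross_log Y X \<ge> \<eta> * (M \<bullet> Y) - \<eta> * (M \<bullet> X) - \<eta>^2 * ((M ** M) \<bullet> X)"
proof -
  have sX: "transpose X = X" and sY: "transpose Y = Y"
    using X Y by (auto simp: density_def)
  note oX = orthonormal_eigvec[OF sX] and oY = orthonormal_eigvec[OF sY] and oM = orthonormal_eigvec[OF M]
  have "neg_entropy Y = (\<Sum>i\<in>UNIV. \<Sum>j\<in>UNIV. eigval Y i * (eigvec Y i \<bullet> eigvec X j)^2 * ln (eigval Y i))"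
  proof -
    have "(\<Sum>j\<in>UNIV. (eigvec Y i \<bullet> eigvec X j)^2) = 1" for i
      using orthonormal_parseval[OF oX, of "eigvec Y i" "eigvec Y i"] oY
      by (simp add: orthonormal_def power2_eq_square inner_commute)
    then show ?thesis
      unfolding neg_entropy_def by (simp flip: sum_distrib_left sum_distrib_right)
  qed
  moreover have "cross_log Y X = (\<Sum>i\<in>UNIV. \<Sum>j\<in>UNIV. eigval Y i * (eigvec Y i \<bullet> eigvec X j)^2 * ln (eigval X j))"
    unfolding cross_log_def quadratic_form_eigen[OF sY] sum_distrib_right by (rule sum.swap)
  ultimately have "neg_entropy Y - cross_log Y X =
      (\<Sum>i\<in>UNIV. \<Sum>j\<in>UNIV. eigval Y i * (eigvec Y i \<bullet> eigvec X j)^2 * (ln (eigval Y i) - ln (eigval X j)))"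
    by (simp add: right_diff_distrib sum_subtractf)
  also have "\<dots> \<ge> (\<Sum>k\<in>UNIV. (\<Sum>i\<in>UNIV. eigval Y i * (eigvec Y i \<bullet> eigvec M k)^2) * (\<eta> * eigval M k)
      + (\<Sum>i\<in>UNIV. eigval Y i * (eigvec Y i \<bullet> eigvec M k)^2)
      - (\<Sum>i\<in>UNIV. eigval X i * (eigvec X i \<bullet> eigvec M k)^2) * exp (\<eta> * eigval M k))"
  proof (rule relative_entropy_ge_measured[OF oY oX oM eigval_density(1)[OF X] eigval_density(1)[OF Y]])
    fix i j assume "eigval X j = 0"
    then have "eigvec X j \<bullet> (Y *v eigvec X j) = 0"
      by (intro ker) (simp add: eigval_def)
    \<comment> \<open>The vanishing quadratic form of \<open>Y\<close> is a sum of nonnegative terms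
      over its eigenbasis.\<close>
    then show "eigval Y i * (eigvec Y i \<bullet> eigvec X j)^2 = 0"
      unfolding quadratic_form_eigen[OF sY]
      by (subst (asm) sum_nonneg_eq_0_iff) (auto simp: eigval_density(1)[OF Y])
  qed
  finally have 1: "(\<Sum>k\<in>UNIV. (eigvec M k \<bullet> (Y *v eigvec M k)) * (\<eta> * eigval M k)
      + (eigvec M k \<bullet> (Y *v eigvec M k)) - (eigvec M k \<bullet> (X *v eigvec M k)) * exp (\<eta> * eigval M k))
      \<le> neg_entropy Y - cross_log Y X"
    unfolding quadratic_form_eigen[OF sY] quadratic_form_eigen[OF sX] by simp
  have "(\<Sum>k\<in>UNIV. (eigvec M k \<bullet> (X *v eigvec M k)) * exp (\<eta> * eigval M k))
    \<le> (\<Sum>k\<in>UNIV. (eigvec M k \<bullet> (X *v eigvec M k)) * (1 + (\<eta> * eigval M k + (\<eta> * eigval M k)^2)))"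
    unfolding add.assoc[symmetric] using X by (intro sum_mono mult_left_mono exp_le_quadratic small) (auto simp: density_def)
  also have "\<dots> = 1 + \<eta> * (M \<bullet> X) + \<eta>^2 * ((M ** M) \<bullet> X)"
    using density_orthonormal_weights(2)[OF X oM]
    by (simp add: inner_matrix_eigen[OF M] inner_square_eigen[OF M] distrib_left[of "_ \<bullet> _"] sum.distrib
        sum_distrib_left power_mult_distrib mult_ac)
  finally have 2: "(\<Sum>k\<in>UNIV. (eigvec M k \<bullet> (X *v eigvec M k)) * exp (\<eta> * eigval M k))
    \<le> 1 + \<eta> * (M \<bullet> X) + \<eta>^2 * ((M ** M) \<bullet> X)" .
  have 3: "(\<Sum>k\<in>UNIV. (eigvec M k \<bullet> (Y *v eigvec M k)) * (\<eta> * eigval M k)) = \<eta> * (M \<bullet> Y)"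
    by (simp add: inner_matrix_eigen[OF M] sum_distrib_left mult_ac)
  show ?thesis
    using 1 2 3 density_orthonormal_weights(2)[OF Y oM] by (simp add: sum.distrib sum_subtractf)
qed

text \<open>Klein's inequality, as the case \<eta> = 0 of the quadratic bound.\<close>

lemma relative_entropy_nonneg:
  fixes X Y :: "real ^ 'n::finite ^ 'n"
  assumes X: "density X" and Y: "density Y"
    and ker: "\<And>u. u \<bullet> (X *v u) = 0 \<Longrightarrow> u \<bullet> (Y *v u) = 0"
  shows "neg_entropy Y - cross_log Y X \<ge> 0"
  using relative_entropy_ge_quadratic[OF X Y, of "mat 1" 0] ker by (simp add: transpose_mat)

text \<open>The inner products are averages of the eigenvalues of \<open>M\<close> and of their
  squares, weighted by the measurement of \<open>X\<close> in the eigenbasis.\<close>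

lemma density_inner_bounds:
  fixes X M :: "real ^ 'n::finite ^ 'n"
  assumes X: "density X" and M: "transpose M = M" and R: "spectral_norm M \<le> R"
  shows "\<bar>M \<bullet> X\<bar> \<le> R" "0 \<le> (M ** M) \<bullet> X" "(M ** M) \<bullet> X \<le> R^2"
proof -
  note w = density_orthonormal_weights[OF X orthonormal_eigvec[OF M]]
  have e: "\<bar>eigval M i\<bar> \<le> R" for i
    using abs_eigval_le[OF M, of i] R by linarith
  have e2: "(eigval M i)^2 \<le> R^2" for i
    using power_mono[OF e[of i], of 2] by simp
  have "\<bar>M \<bullet> X\<bar> \<le> (\<Sum>i\<in>UNIV. \<bar>eigval M i\<bar> * (eigvec M i \<bullet> (X *v eigvec M i)))"
    unfolding inner_matrix_eigen[OF M] using w(1) by (intro order_trans[OF sum_abs] sum_mono) (simp add: abs_mult)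
  also have "\<dots> \<le> (\<Sum>i\<in>UNIV. R * (eigvec M i \<bullet> (X *v eigvec M i)))"
    by (intro sum_mono mult_right_mono e w)
  finally show "\<bar>M \<bullet> X\<bar> \<le> R"
    using w(2) by (simp flip: sum_distrib_left)
  show "0 \<le> (M ** M) \<bullet> X"
    unfolding inner_square_eigen[OF M] using w(1) by (intro sum_nonneg) auto
  have "(M ** M) \<bullet> X \<le> (\<Sum>i\<in>UNIV. R^2 * (eigvec M i \<bullet> (X *v eigvec M i)))"
    unfolding inner_square_eigen[OF M] by (intro sum_mono mult_right_mono e2 w)
  then show "(M ** M) \<bullet> X \<le> R^2"
    using w(2) by (simp flip: sum_distrib_left)
qed

lemma norm_density_le:
  assumes "density X"
  shows "norm X \<le> 1"
proof -
  have "X \<bullet> X = (\<Sum>i\<in>UNIV. eigval X i * eigval X i)"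
    using assms inner_matrix_eigen[of X X] by (simp add: density_def eigval_def)
  also have "\<dots> \<le> (\<Sum>i\<in>UNIV. eigval X i * 1)"
    by (intro sum_mono mult_left_mono eigval_density[OF assms])
  also have "\<dots> = 1"
    using eigval_density(2)[OF assms] by simp
  finally show ?thesis
    by (simp add: norm_le_square)
qed

section \<open>The entropic potential\<close>

text \<open>A step of size \<open>t\<close> from the near-optimal \<open>Xs\<close> towards
  \<open>Y\<close> gives \<open>X\<close>, whose kernel lies in the kernels of both, so that
  relative entropies with respect to \<open>X\<close> are meaningful even for singular
  \<open>Xs\<close>. Averaged over the mixture they equal the convexity gap of the negative entropy,
  and near-optimality of \<open>Xs\<close> bounds that gap by
  \<open>\<eta> * t * (f S Xs - f S Y + t)\<close>. The slack \<open>t^2\<close> thus survives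
  division by \<open>t\<close> as an error \<open>t\<close>.\<close>

lemma regularized_maximizer_step:
  fixes S M :: "real ^ 'n::finite ^ 'n" and \<eta> :: real
  defines "f \<equiv> \<lambda>A X. A \<bullet> X - neg_entropy X / \<eta>"
  assumes K: "convex K" "\<And>X. X \<in> K \<Longrightarrow> density X" and \<eta>: "\<eta> > 0"
    and small: "\<eta> * R \<le> 3/2" and t: "0 < t" "t < 1"
    and Xs: "Xs \<in> K" "\<And>X. X \<in> K \<Longrightarrow> f S X \<le> f S Xs + t^2"
    and M: "transpose M = M" "spectral_norm M \<le> R" and Y: "Y \<in> K"
  shows "f (S + M) Y \<le> f S Xs + M \<bullet> Xs + \<eta> * ((M ** M) \<bullet> Xs) + t * (1 + 2 * R + \<eta> * R^2)"
proof -
  define X where "X = (1 - t) *\<^sub>R Xs + t *\<^sub>R Y"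
  have XK: "X \<in> K"
    unfolding X_def using K(1) Xs(1) Y t by (simp add: convexD_alt)
  have dX: "density X" and dXs: "density Xs" and dY: "density Y"
    using XK Xs(1) Y K(2) by auto
  have qf: "u \<bullet> (X *v u) = (1 - t) * (u \<bullet> (Xs *v u)) + t * (u \<bullet> (Y *v u))" for u
    by (simp add: X_def matrix_vector_mult_add_rdistrib inner_add_right flip: scaleR_matrix_vector_assoc)
  have nn: "u \<bullet> (Xs *v u) \<ge> 0" "u \<bullet> (Y *v u) \<ge> 0" for u
    using dXs dY by (auto simp: density_def)
  have ker: "u \<bullet> (Xs *v u) = 0 \<and> u \<bullet> (Y *v u) = 0" if "u \<bullet> (X *v u) = 0" for u
  proof -
    have "(1 - t) * (u \<bullet> (Xs *v u)) \<ge> 0" "t * (u \<bullet> (Y *v u)) \<ge> 0"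
      using nn t by auto
    with that qf[of u] have "(1 - t) * (u \<bullet> (Xs *v u)) = 0 \<and> t * (u \<bullet> (Y *v u)) = 0"
      by linarith
    then show ?thesis using t by simp
  qed
  have \<open>\<eta> * eigval M k \<le> 3/2\<close> for k
  proof -
    have "\<eta> * eigval M k \<le> \<eta> * R"
      using abs_eigval_le[OF M(1), of k] M(2) \<eta> by (intro mult_left_mono) auto
    then show ?thesis using small by linarith
  qed
  then have dY_X: "neg_entropy Y - cross_log Y X \<ge> \<eta> * (M \<bullet> Y) - \<eta> * (M \<bullet> X) - \<eta>^2 * ((M ** M) \<bullet> X)"
    using ker by (intro relative_entropy_ge_quadratic dX dY M(1)) auto
  have dXs_X: "neg_entropy Xs - cross_log Xs X \<ge> 0"
    using ker by (intro relative_entropy_nonneg dX dXs) auto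
  \<comment> \<open>\<open>cross_log\<close> is linear in its first argument, and \<open>X\<close>
    is the mixture.\<close>
  have hX: "neg_entropy X = (1 - t) * cross_log Xs X + t * cross_log Y X"
    using cross_log_self[of X] by (simp add: X_def cross_log_add cross_log_scaleR)
  have "t * (neg_entropy Y - cross_log Y X) \<le>
      t * (neg_entropy Y - cross_log Y X) + (1 - t) * (neg_entropy Xs - cross_log Xs X)"
    using dXs_X t by simp
  also have "\<dots> = t * neg_entropy Y + (1 - t) * neg_entropy Xs - neg_entropy X"
    by (simp add: hX algebra_simps)
  also have "\<dots> = \<eta> * (f S X - (1 - t) * f S Xs - t * f S Y)"
  proof -
    have 1: "S \<bullet> X = (1 - t) * (S \<bullet> Xs) + t * (S \<bullet> Y)"
      by (simp add: X_def inner_add_right)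
    have 2: "\<eta> * f S Z = \<eta> * (S \<bullet> Z) - neg_entropy Z" for Z
      using \<eta> by (simp add: f_def right_diff_distrib)
    have 3: "\<eta> * (f S X - (1 - t) * f S Xs - t * f S Y)
        = \<eta> * f S X - (1 - t) * (\<eta> * f S Xs) - t * (\<eta> * f S Y)"
      by (simp add: algebra_simps)
    show ?thesis
      unfolding 3 2 1 by (simp add: algebra_simps)
  qed
  also have "\<dots> \<le> \<eta> * (f S Xs + t^2 - (1 - t) * f S Xs - t * f S Y)"
    using \<eta> Xs(2)[OF XK] by (intro mult_left_mono) auto
  also have "\<dots> = t * (\<eta> * (f S Xs - f S Y + t))"
    by (simp add: algebra_simps power2_eq_square)
  finally have "neg_entropy Y - cross_log Y X \<le> \<eta> * (f S Xs - f S Y + t)"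
    using t by simp
  with dY_X have "\<eta> * (M \<bullet> Y - M \<bullet> X - \<eta> * ((M ** M) \<bullet> X)) \<le> \<eta> * (f S Xs - f S Y + t)"
    by (simp add: algebra_simps power2_eq_square)
  then have 1: "M \<bullet> Y - M \<bullet> X - \<eta> * ((M ** M) \<bullet> X) \<le> f S Xs - f S Y + t"
    using \<eta> by simp
  have MX: "M \<bullet> X = M \<bullet> Xs + t * (M \<bullet> Y - M \<bullet> Xs)"
    by (simp add: X_def inner_add_right algebra_simps)
  have MMX: "(M ** M) \<bullet> X = (M ** M) \<bullet> Xs + t * ((M ** M) \<bullet> Y - (M ** M) \<bullet> Xs)"
    by (simp add: X_def inner_add_right algebra_simps)
  \<comment> \<open>Passing from \<open>X\<close> back to \<open>Xs\<close> costs \<open>t\<close>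
    times this bounded quantity.\<close>
  have "M \<bullet> Y - M \<bullet> Xs + \<eta> * ((M ** M) \<bullet> Y - (M ** M) \<bullet> Xs) \<le> 2 * R + \<eta> * R^2"
    using density_inner_bounds[OF dY M] density_inner_bounds[OF dXs M] \<eta>
    by (intro add_mono mult_left_mono) auto
  then have 2: "t * (M \<bullet> Y - M \<bullet> Xs + \<eta> * ((M ** M) \<bullet> Y - (M ** M) \<bullet> Xs)) \<le> t * (2 * R + \<eta> * R^2)"
    using t by simp
  have "f (S + M) Y = f S Y + M \<bullet> Y"
    by (simp add: f_def inner_add_left)
  also have "\<dots> \<le> f S Xs + t + M \<bullet> X + \<eta> * ((M ** M) \<bullet> X)"
    using 1 by linarith
  also have "\<dots> = f S Xs + M \<bullet> Xs + \<eta> * ((M ** M) \<bullet> Xs) + t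
      + t * (M \<bullet> Y - M \<bullet> Xs + \<eta> * ((M ** M) \<bullet> Y - (M ** M) \<bullet> Xs))"
    by (simp add: MX MMX algebra_simps)
  also have "\<dots> \<le> f S Xs + M \<bullet> Xs + \<eta> * ((M ** M) \<bullet> Xs) + t * (1 + 2 * R + \<eta> * R^2)"
    using 2 by (simp add: algebra_simps)
  finally show ?thesis .
qed

text \<open>The convex conjugate of the scaled negative entropy restricted to \<open>K\<close>. Over
  all density matrices, and for symmetric \<open>S\<close>, it would be
  \<open>ln (tr (exp (\<eta> S))) / \<eta>\<close>.\<close>

definition potential :: "real \<Rightarrow> (real ^ 'n::finite ^ 'n) set \<Rightarrow> real ^ 'n ^ 'n \<Rightarrow> real" where
  "potential \<eta> K S = (SUP X\<in>K. S \<bullet> X - neg_entropy X / \<eta>)"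

text \<open>Separates the matrix argument from pseudoexpectations; the instance of interest is the
  set of moment matrices.\<close>

locale density_set =
  fixes K :: "(real ^ 'n::finite ^ 'n) set"
  assumes convex: "convex K" and nonempty: "K \<noteq> {}" and density: "X \<in> K \<Longrightarrow> density X"
begin

lemma abs_inner_le: "X \<in> K \<Longrightarrow> \<bar>S \<bullet> X\<bar> \<le> norm S"
  using Cauchy_Schwarz_ineq2[of S X] norm_density_le[OF density, of X]
  by (meson mult_left_le norm_ge_zero order_trans)

lemma bdd_above_potential:
  assumes "\<eta> > 0"
  shows "bdd_above ((\<lambda>X. S \<bullet> X - neg_entropy X / \<eta>) ` K)"
proof (rule bdd_aboveI2)
  fix X assume X: "X \<in> K"
  have "- neg_entropy X / \<eta> \<le> ln (real CARD('n)) / \<eta>"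
    using neg_entropy_ge[OF density[OF X]] assms by (intro divide_right_mono) auto
  then show "S \<bullet> X - neg_entropy X / \<eta> \<le> norm S + ln (real CARD('n)) / \<eta>"
    using abs_inner_le[OF X, of S] by auto
qed

lemma inner_le_potential:
  assumes "\<eta> > 0" "X \<in> K"
  shows "S \<bullet> X \<le> potential \<eta> K S"
proof -
  have "S \<bullet> X \<le> S \<bullet> X - neg_entropy X / \<eta>"
    using neg_entropy_nonpos[OF density[OF assms(2)]] assms(1) by (simp add: divide_le_0_iff)
  also have "\<dots> \<le> potential \<eta> K S"
    unfolding potential_def by (intro cSUP_upper bdd_above_potential assms)
  finally show ?thesis .
qed

lemma potential_zero_le:
  assumes "\<eta> > 0"
  shows "potential \<eta> K 0 \<le> ln (real CARD('n)) / \<eta>"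
  unfolding potential_def
proof (rule cSUP_least[OF nonempty])
  fix X assume X: "X \<in> K"
  have "- neg_entropy X / \<eta> \<le> ln (real CARD('n)) / \<eta>"
    using neg_entropy_ge[OF density[OF X]] assms by (intro divide_right_mono) auto
  then show "0 \<bullet> X - neg_entropy X / \<eta> \<le> ln (real CARD('n)) / \<eta>"
    by simp
qed

text \<open>Since \<open>norm X \<le> 1\<close> on \<open>K\<close>, each competing value changes by
  at most \<open>norm T\<close>. The resulting Lipschitz continuity supplies measurability and
  integrability of the random potential.\<close>

lemma potential_add_le:
  assumes "\<eta> > 0"
  shows "potential \<eta> K (S + T) \<le> potential \<eta> K S + norm T"
  unfolding potential_def[of _ _ "S + T"]
proof (rule cSUP_least[OF nonempty])
  fix X assume X: "X \<in> K"
  have "S \<bullet> X - neg_entropy X / \<eta> \<le> potential \<eta> K S"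
    unfolding potential_def by (intro cSUP_upper bdd_above_potential assms X)
  then show "(S + T) \<bullet> X - neg_entropy X / \<eta> \<le> potential \<eta> K S + norm T"
    using abs_inner_le[OF X, of T] by (simp add: inner_add_left)
qed

lemma continuous_potential:
  assumes "\<eta> > 0"
  shows "continuous_on UNIV (potential \<eta> K)"
proof -
  have "1-lipschitz_on UNIV (potential \<eta> K)"
  proof (rule lipschitz_onI)
    fix S T :: "real ^ 'n ^ 'n"
    show "dist (potential \<eta> K S) (potential \<eta> K T) \<le> 1 * dist S T"
      using potential_add_le[OF assms, of T "S - T"] potential_add_le[OF assms, of S "T - S"]
      by (simp add: dist_norm norm_minus_commute abs_le_iff)
  qed simp
  then show ?thesis
    by (rule lipschitz_on_continuous_on)
qed

lemma abs_potential_le: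
  assumes "\<eta> > 0"
  shows "\<bar>potential \<eta> K S\<bar> \<le> \<bar>potential \<eta> K 0\<bar> + norm S"
  using potential_add_le[OF assms, of 0 S] potential_add_le[OF assms, of S "- S"] by auto

text \<open>\<open>X\<close> may depend on \<open>S\<close> and \<open>t\<close> but not on
  \<open>M\<close>: this order of quantifiers allows the bound to be averaged over a random
  \<open>M\<close>.\<close>

lemma potential_step:
  assumes \<eta>: "\<eta> > 0" and small: "\<eta> * R \<le> 3/2" and t: "0 < t" "t < 1"
  shows "\<exists>X\<in>K. \<forall>M. transpose M = M \<longrightarrow> spectral_norm M \<le> R \<longrightarrow>
    potential \<eta> K (S + M) \<le> potential \<eta> K S + M \<bullet> X + \<eta> * ((M ** M) \<bullet> X) + t * (1 + 2 * R + \<eta> * R^2)"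
proof -
  let ?f = "\<lambda>A X. A \<bullet> X - neg_entropy X / \<eta>"
  have "potential \<eta> K S - t^2 < potential \<eta> K S"
    using t by simp
  \<comment> \<open>A competitor within \<open>t^2\<close> of the supremum stands in for a
    maximizer, matching the slack in \<open>regularized_maximizer_step\<close>.\<close>
  then obtain X where X: "X \<in> K" "potential \<eta> K S - t^2 < ?f S X"
    unfolding potential_def using less_cSUP_iff[OF nonempty bdd_above_potential[OF \<eta>]] by blast
  have ub: "?f S Y \<le> potential \<eta> K S" if "Y \<in> K" for Y
    unfolding potential_def by (intro cSUP_upper bdd_above_potential \<eta> that)
  have near: "?f S Y \<le> ?f S X + t^2" if "Y \<in> K" for Y
    using ub[OF that] X(2) by linarith
  show ?thesis
  proof (intro bexI[OF _ X(1)] allI impI)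
    fix M :: "real ^ 'n ^ 'n" assume M: "transpose M = M" "spectral_norm M \<le> R"
    show "potential \<eta> K (S + M) \<le>
        potential \<eta> K S + M \<bullet> X + \<eta> * ((M ** M) \<bullet> X) + t * (1 + 2 * R + \<eta> * R^2)"
      unfolding potential_def[of _ _ "S + M"]
    proof (rule cSUP_least[OF nonempty])
      fix Y assume Y: "Y \<in> K"
      show "?f (S + M) Y \<le> potential \<eta> K S + M \<bullet> X + \<eta> * ((M ** M) \<bullet> X) + t * (1 + 2 * R + \<eta> * R^2)"
        using regularized_maximizer_step[OF convex density \<eta> small t X(1) near M Y] ub[OF X(1)] by linarith
    qed
  qed
qed

end

section \<open>Sums of independent random matrices\<close>

text \<open>The squared Frobenius norm is the sum of the squared eigenvalues. Enlarging the
  dimension factor to its square avoids a root; the bound serves integrability only and does not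
  enter the final constants.\<close>

lemma norm_symmetric_le:
  fixes M :: "real ^ 'n::finite ^ 'n"
  assumes M: "transpose M = M" and R: "spectral_norm M \<le> R"
  shows "norm M \<le> real CARD('n) * R"
proof -
  have e: "\<bar>eigval M i\<bar> \<le> R" for i
    using abs_eigval_le[OF M, of i] R by linarith
  then have R0: "R \<ge> 0"
    by (meson abs_ge_zero order_trans)
  have e2: "eigval M i * eigval M i \<le> R * R" for i
    using power_mono[OF e[of i], of 2] by (simp add: power2_eq_square)
  have "M \<bullet> M = (\<Sum>i\<in>UNIV. eigval M i * eigval M i)"
    using inner_matrix_eigen[OF M, of M] by (simp add: eigval_def)
  also have "\<dots> \<le> real CARD('n) * (R * R)"
    using sum_mono[of UNIV "\<lambda>i. eigval M i * eigval M i" "\<lambda>_. R * R"] e2 by simp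
  also have "\<dots> \<le> (real CARD('n) * real CARD('n)) * (R * R)"
    by (intro mult_right_mono) (auto simp: Suc_le_eq)
  finally show ?thesis
    using R0 by (simp add: norm_le_square power2_eq_square mult_ac)
qed

lemma borel_measurable_matrix_square:
  fixes M :: "'w \<Rightarrow> real ^ 'n::finite ^ 'n"
  assumes "M \<in> borel_measurable P"
  shows "(\<lambda>\<omega>. M \<omega> ** M \<omega>) \<in> borel_measurable P"
proof -
  have "continuous_on UNIV (\<lambda>A :: real ^ 'n ^ 'n. A ** A)"
    unfolding matrix_matrix_mult_def by (intro continuous_intros)
  then show ?thesis
    using assms by (rule borel_measurable_continuous_on)
qed

lemma norm_matrix_square_le:
  fixes A :: "real ^ 'n::finite ^ 'n"
  assumes "transpose A = A"
  shows "norm (A ** A) \<le> real CARD('n) * (spectral_norm A)^2"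
proof (rule norm_symmetric_le)
  show "transpose (A ** A) = A ** A"
    by (simp add: matrix_transpose_mul assms)
  have bl: "bounded_linear ((*v) A)"
    by (rule matrix_vector_mul_bounded_linear)
  have "spectral_norm (A ** A) = onorm ((*v) A \<circ> (*v) A)"
    by (simp add: o_def matrix_vector_mul_assoc)
  also have "\<dots> \<le> (spectral_norm A)^2"
    using onorm_compose[OF bl bl] by (simp add: power2_eq_square)
  finally show "spectral_norm (A ** A) \<le> (spectral_norm A)^2" .
qed

context prob_space
begin

lemma integrable_bounded_symmetric:
  fixes A :: "'a \<Rightarrow> real ^ 'n::finite ^ 'n"
  assumes A: "A \<in> borel_measurable M"
    and symm: "\<forall>\<omega>\<in>space M. transpose (A \<omega>) = A \<omega>"
    and bound: "AE \<omega> in M. spectral_norm (A \<omega>) \<le> R"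
  shows "AE \<omega> in M. norm (A \<omega>) \<le> real CARD('n) * R"
    and "integrable M A" and "integrable M (\<lambda>\<omega>. A \<omega> ** A \<omega>)"
proof -
  show 1: "AE \<omega> in M. norm (A \<omega>) \<le> real CARD('n) * R"
    using bound AE_space by eventually_elim (simp add: norm_symmetric_le symm)
  show "integrable M A"
    by (rule integrable_const_bound[OF 1 A])
  have "AE \<omega> in M. norm (A \<omega> ** A \<omega>) \<le> real CARD('n) * R^2"
    using bound AE_space
  proof eventually_elim
    case (elim \<omega>)
    have "norm (A \<omega> ** A \<omega>) \<le> real CARD('n) * (spectral_norm (A \<omega>))^2"
      by (rule norm_matrix_square_le[OF symm[rule_format, OF elim(2)]])
    also have "\<dots> \<le> real CARD('n) * R^2"
      using elim(1) by (intro mult_left_mono power_mono onorm_pos_le matrix_vector_mul_bounded_linear) auto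
    finally show ?case .
  qed
  then show "integrable M (\<lambda>\<omega>. A \<omega> ** A \<omega>)"
    by (rule integrable_const_bound[OF _ borel_measurable_matrix_square[OF A]])
qed

lemma indep_var_partial_sum:
  fixes A :: "nat \<Rightarrow> 'a \<Rightarrow> 'b::{second_countable_topology, real_normed_vector}"
  assumes indep: "indep_vars (\<lambda>_. borel) A {..<k}" and n: "n < k"
  shows "indep_var borel (\<lambda>\<omega>. \<Sum>i<n. A i \<omega>) borel (A n)"
proof -
  have "indep_var (PiM {..<n} (\<lambda>_. borel)) (\<lambda>\<omega>. restrict (\<lambda>i. A i \<omega>) {..<n})
      (PiM {n} (\<lambda>_. borel)) (\<lambda>\<omega>. restrict (\<lambda>i. A i \<omega>) {n})"
    using n by (intro indep_var_restrict[OF indep]) auto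
  then have "indep_var borel ((\<lambda>f. \<Sum>i<n. f i) \<circ> (\<lambda>\<omega>. restrict (\<lambda>i. A i \<omega>) {..<n}))
      borel ((\<lambda>f. f n) \<circ> (\<lambda>\<omega>. restrict (\<lambda>i. A i \<omega>) {n}))"
    by (rule indep_var_compose) auto
  then show ?thesis
    by (simp add: o_def)
qed

end

context density_set
begin

lemma borel_measurable_potential:
  assumes "\<eta> > 0" "A \<in> borel_measurable P"
  shows "(\<lambda>\<omega>. potential \<eta> K (A \<omega>)) \<in> borel_measurable P"
  by (rule borel_measurable_continuous_on[OF continuous_potential[OF assms(1)] assms(2)])

lemma integrable_potential:
  assumes "prob_space P" "\<eta> > 0" "A \<in> borel_measurable P" and AE: "AE \<omega> in P. norm (A \<omega>) \<le> B"
  shows "integrable P (\<lambda>\<omega>. potential \<eta> K (A \<omega>))"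
proof -
  interpret prob_space P by fact
  show ?thesis
  proof (rule integrable_const_bound)
    show "AE \<omega> in P. norm (potential \<eta> K (A \<omega>)) \<le> \<bar>potential \<eta> K 0\<bar> + B"
      using AE
    proof eventually_elim
      case (elim \<omega>)
      then show ?case
        using abs_potential_le[OF assms(2), of "A \<omega>"] by simp
    qed
  qed (rule borel_measurable_potential[OF assms(2,3)])
qed

text \<open>For fixed \<open>S\<close>, averaging \<open>potential_step\<close> removes the linear
  term by \<open>mean\<close> and bounds the quadratic one by \<open>variance\<close> at the chosen
  \<open>X\<close>. The remaining error is arbitrarily small with \<open>t\<close>.\<close>

lemma expected_potential_step:
  fixes A :: "'w \<Rightarrow> real ^ 'n ^ 'n"
  assumes P: "prob_space P" and A: "A \<in> borel_measurable P" and mean: "(\<integral>\<omega>. A \<omega> \<partial>P) = 0"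
    and symm: "\<forall>\<omega>\<in>space P. transpose (A \<omega>) = A \<omega>"
    and bound: "AE \<omega> in P. spectral_norm (A \<omega>) \<le> R" and R: "R > 0"
    and variance: "\<And>X. X \<in> K \<Longrightarrow> (\<integral>\<omega>. A \<omega> ** A \<omega> \<partial>P) \<bullet> X \<le> v"
    and \<eta>: "\<eta> > 0" "\<eta> * R \<le> 3/2"
  shows "(\<integral>\<omega>. potential \<eta> K (S + A \<omega>) \<partial>P) \<le> potential \<eta> K S + \<eta> * v"
proof (rule field_le_epsilon)
  interpret prob_space P by fact
  fix e :: real assume e: "e > 0"
  define C where "C = 1 + 2 * R + \<eta> * R^2"
  have C: "C > 0" using R \<eta> by (simp add: C_def add_pos_nonneg)
  \<comment> \<open>The first entry keeps \<open>t < 1\<close>, the second makes the error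
    \<open>t * C\<close> at most \<open>e\<close>.\<close>
  define t where "t = min (1/2) (e / C)"
  have t: "0 < t" "t < 1" "t * C \<le> e"
    using e C by (auto simp: t_def min_def field_simps)
  obtain X where X: "X \<in> K" "\<And>M. transpose M = M \<Longrightarrow> spectral_norm M \<le> R \<Longrightarrow>
    potential \<eta> K (S + M) \<le> potential \<eta> K S + M \<bullet> X + \<eta> * ((M ** M) \<bullet> X) + t * C"
    using potential_step[OF \<eta> t(1,2), of S] unfolding C_def by blast
  note int = integrable_bounded_symmetric[OF A symm bound]
  have "AE \<omega> in P. norm (S + A \<omega>) \<le> norm S + real CARD('n) * R"
    using int(1) by eventually_elim (meson add_left_mono norm_triangle_ineq order_trans)
  then have "integrable P (\<lambda>\<omega>. potential \<eta> K (S + A \<omega>))"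
    by (intro integrable_potential[OF P \<eta>(1)]) (use A in simp_all)
  moreover have "AE \<omega> in P. potential \<eta> K (S + A \<omega>) \<le>
      potential \<eta> K S + A \<omega> \<bullet> X + \<eta> * ((A \<omega> ** A \<omega>) \<bullet> X) + t * C"
    using bound AE_space by eventually_elim (simp add: X(2) symm)
  ultimately have "(\<integral>\<omega>. potential \<eta> K (S + A \<omega>) \<partial>P) \<le>
      (\<integral>\<omega>. potential \<eta> K S + A \<omega> \<bullet> X + \<eta> * ((A \<omega> ** A \<omega>) \<bullet> X) + t * C \<partial>P)"
    using int by (intro integral_mono_AE) simp_all
  also have "\<dots> = potential \<eta> K S + \<eta> * ((\<integral>\<omega>. A \<omega> ** A \<omega> \<partial>P) \<bullet> X) + t * C"
    using int mean by (simp add: prob_space)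
  also have "\<dots> \<le> potential \<eta> K S + \<eta> * v + e"
    using variance[OF X(1)] \<eta>(1) t(3) by (intro add_mono mult_left_mono) auto
  finally show "(\<integral>\<omega>. potential \<eta> K (S + A \<omega>) \<partial>P) \<le> potential \<eta> K S + \<eta> * v + e" .
qed

text \<open>Induction on the number of summands. By independence the partial sum and the next
  summand have a product law, so Fubini lets the one-step bound be applied with the partial sum
  frozen at a constant \<open>s\<close>.\<close>

lemma expected_potential_sum_le:
  fixes A :: "nat \<Rightarrow> 'w \<Rightarrow> real ^ 'n ^ 'n"
  assumes P: "prob_space P" and indep: "prob_space.indep_vars P (\<lambda>_. borel) A {..<k}"
    and mean: "\<And>i. i < k \<Longrightarrow> (\<integral>\<omega>. A i \<omega> \<partial>P) = 0"
    and symm: "\<And>i. i < k \<Longrightarrow> \<forall>\<omega>\<in>space P. transpose (A i \<omega>) = A i \<omega>"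
    and R: "R > 0" and bound: "\<And>i. i < k \<Longrightarrow> AE \<omega> in P. spectral_norm (A i \<omega>) \<le> R"
    and variance: "\<And>i X. i < k \<Longrightarrow> X \<in> K \<Longrightarrow> (\<integral>\<omega>. A i \<omega> ** A i \<omega> \<partial>P) \<bullet> X \<le> v"
    and \<eta>: "\<eta> > 0" "\<eta> * R \<le> 3/2"
  shows "integrable P (\<lambda>\<omega>. potential \<eta> K (\<Sum>i<k. A i \<omega>))"
    and "(\<integral>\<omega>. potential \<eta> K (\<Sum>i<k. A i \<omega>) \<partial>P) \<le> ln (real CARD('n)) / \<eta> + real k * (\<eta> * v)"
proof -
  interpret prob_space P by fact
  have meas: "A i \<in> borel_measurable P" if "i < k" for i
    using indep that by (auto simp: indep_vars_def)
  note int = integrable_bounded_symmetric[OF meas symm bound]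
  have bdd: "AE \<omega> in P. norm (\<Sum>i<n. A i \<omega>) \<le> real n * (real CARD('n) * R)" if "n \<le> k" for n
  proof -
    have "AE \<omega> in P. \<forall>i\<in>{..<n}. norm (A i \<omega>) \<le> real CARD('n) * R"
      using int(1) that by (intro AE_finite_allI) auto
    then show ?thesis
    proof eventually_elim
      case (elim \<omega>)
      then have "(\<Sum>i<n. norm (A i \<omega>)) \<le> (\<Sum>i<n. real CARD('n) * R)"
        by (intro sum_mono) auto
      then show ?case
        using norm_sum[of "\<lambda>i. A i \<omega>" "{..<n}"] by simp
    qed
  qed
  have measS: "(\<lambda>\<omega>. \<Sum>i<n. A i \<omega>) \<in> borel_measurable P" if "n \<le> k" for n
    using that by (intro borel_measurable_sum meas) auto
  have intS: "integrable P (\<lambda>\<omega>. potential \<eta> K (\<Sum>i<n. A i \<omega>))" if "n \<le> k" for n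
    by (intro integrable_potential[OF P \<eta>(1) measS bdd] that)
  then show "integrable P (\<lambda>\<omega>. potential \<eta> K (\<Sum>i<k. A i \<omega>))" by simp
  have "(\<integral>\<omega>. potential \<eta> K (\<Sum>i<n. A i \<omega>) \<partial>P) \<le> ln (real CARD('n)) / \<eta> + real n * (\<eta> * v)" if "n \<le> k" for n
    using that
  proof (induction n)
    case 0
    then show ?case
      using potential_zero_le[OF \<eta>(1)] by (simp add: prob_space)
  next
    case (Suc n)
    then have n: "n < k" by simp
    let ?S = "\<lambda>\<omega>. \<Sum>i<n. A i \<omega>"
    let ?dS = "distr P borel ?S" and ?dA = "distr P borel (A n)"
    note mA [measurable] = meas[OF n]
    have [measurable]: "potential \<eta> K \<in> borel_measurable borel"
      by (rule borel_measurable_continuous_onI[OF continuous_potential[OF \<eta>(1)]])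
    have mS' [measurable]: "?S \<in> borel_measurable P"
      using n by (intro measS) simp
    have joint: "?dS \<Otimes>\<^sub>M ?dA = distr P (borel \<Otimes>\<^sub>M borel) (\<lambda>\<omega>. (?S \<omega>, A n \<omega>))"
      using indep_var_partial_sum[OF indep n] by (simp add: indep_var_distribution_eq)
    interpret S: prob_space ?dS by (rule prob_space_distr) simp
    interpret A: prob_space ?dA by (rule prob_space_distr) simp
    interpret SA: pair_prob_space ?dS ?dA ..
    have int1: "integrable (?dS \<Otimes>\<^sub>M ?dA) (\<lambda>(s, a). potential \<eta> K (s + a))"
      unfolding joint using intS[of "Suc n"] n by (subst integrable_distr_eq) (simp_all add: case_prod_beta)
    have "(\<integral>\<omega>. potential \<eta> K (\<Sum>i<Suc n. A i \<omega>) \<partial>P) = (\<integral>(s, a). potential \<eta> K (s + a) \<partial>(?dS \<Otimes>\<^sub>M ?dA))"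
      unfolding joint by (subst integral_distr) (simp_all add: case_prod_beta)
    also have "\<dots> = (\<integral>s. (\<integral>a. potential \<eta> K (s + a) \<partial>?dA) \<partial>?dS)"
      using SA.integral_fst'[OF int1] by simp
    also have "\<dots> \<le> (\<integral>s. potential \<eta> K s + \<eta> * v \<partial>?dS)"
    proof (rule integral_mono)
      show "integrable ?dS (\<lambda>s. \<integral>a. potential \<eta> K (s + a) \<partial>?dA)"
        using SA.integrable_fst'[OF int1] by simp
      show "integrable ?dS (\<lambda>s. potential \<eta> K s + \<eta> * v)"
        using intS[of n] n by (simp add: integrable_distr_eq)
      fix s
      have "(\<integral>a. potential \<eta> K (s + a) \<partial>?dA) = (\<integral>\<omega>. potential \<eta> K (s + A n \<omega>) \<partial>P)"
        by (simp add: integral_distr)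
      also have "\<dots> \<le> potential \<eta> K s + \<eta> * v"
        using n by (intro expected_potential_step[OF P mA mean _ bound R _ \<eta>] symm variance)
      finally show "(\<integral>a. potential \<eta> K (s + a) \<partial>?dA) \<le> potential \<eta> K s + \<eta> * v" .
    qed
    also have "\<dots> = (\<integral>\<omega>. potential \<eta> K (?S \<omega>) \<partial>P) + \<eta> * v"
      using intS[of n] n by (simp add: integral_distr prob_space)
    also have "\<dots> \<le> ln (real CARD('n)) / \<eta> + real (Suc n) * (\<eta> * v)"
      using Suc.IH n by (simp add: algebra_simps)
    finally show ?case .
  qed
  then show "(\<integral>\<omega>. potential \<eta> K (\<Sum>i<k. A i \<omega>) \<partial>P) \<le> ln (real CARD('n)) / \<eta> + real k * (\<eta> * v)"
    by simp
qed

end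

text \<open>
  The two branches are the unconstrained minimizer of \<open>\<eta> \<mapsto> l / \<eta> + v * \<eta>\<close>, and the end point of
  the range \<open>\<eta> * R \<le> 3/2\<close>.
\<close>

lemma rate_choice:
  fixes l R v :: real
  assumes l: "l > 0" and R: "R > 0" and v: "v \<ge> 0"
  obtains \<eta> where "\<eta> > 0" "\<eta> * R \<le> 3/2" "l / \<eta> + \<eta> * v \<le> 2 * l / 3 * R + 2 * sqrt (l * v)"
\<comment> \<open>The condition \<open>v > 0\<close> is there because \<open>l / 0 = 0\<close> would
  make the first choice of \<eta> zero.\<close>
proof (cases "v > 0 \<and> sqrt (l / v) \<le> 3 / (2 * R)")
  case True
  define \<eta> where "\<eta> = sqrt (l / v)"
  have \<eta>: "\<eta> > 0" using True l by (simp add: \<eta>_def)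
  have "\<eta> * v = sqrt (l * v)"
    using True l v by (simp add: \<eta>_def real_sqrt_divide real_sqrt_mult field_simps)
  moreover have "l / \<eta> = sqrt (l * v)"
    using True l v by (simp add: \<eta>_def real_sqrt_divide real_sqrt_mult field_simps)
  ultimately have "l / \<eta> + \<eta> * v \<le> 2 * l / 3 * R + 2 * sqrt (l * v)"
    using l R by simp
  then show ?thesis
    using that[of \<eta>] \<eta> True R by (simp add: \<eta>_def field_simps)
next
  case False
  define \<eta> where "\<eta> = 3 / (2 * R)"
  have \<eta>: "\<eta> > 0" "l / \<eta> = 2 * l / 3 * R" using R by (simp_all add: \<eta>_def field_simps)
  have "\<eta> * v \<le> sqrt (l * v)"
  proof (cases "v > 0")
    case True
    \<comment> \<open>Here the unconstrained minimizer \<open>sqrt (l / v)\<close> lies beyond the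
      end point.\<close>
    then have "\<eta> * v \<le> sqrt (l / v) * v"
      using False by (intro mult_right_mono) (auto simp: \<eta>_def)
    also have "\<dots> = sqrt (l * v)"
      using True l v by (simp add: real_sqrt_divide real_sqrt_mult field_simps)
    finally show ?thesis .
  qed (use v in simp)
  moreover have "sqrt (l * v) \<ge> 0" using l v by simp
  ultimately have "l / \<eta> + \<eta> * v \<le> 2 * l / 3 * R + 2 * sqrt (l * v)"
    using \<eta>(2) by linarith
  then show ?thesis
    using that[of \<eta>] \<eta>(1) R by (simp add: \<eta>_def)
qed

section \<open>Polynomials\<close>

lemma mdeg_eq_sum:
  fixes m :: "'d::finite \<Rightarrow>\<^sub>0 nat"
  shows "mdeg m = (\<Sum>i\<in>UNIV. Poly_Mapping.lookup m i)"
  unfolding mdeg_def by (rule sum.mono_neutral_left) (auto simp: in_keys_iff)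

lemma mdeg_add:
  fixes m n :: "'d::finite \<Rightarrow>\<^sub>0 nat"
  shows "mdeg (m + n) = mdeg m + mdeg n"
  by (simp add: mdeg_eq_sum lookup_add sum.distrib)

lemma mdeg_single: "mdeg (Poly_Mapping.single (i::'d::finite) n) = n"
  by (simp add: mdeg_eq_sum lookup_single when_def)

lemma tdeg_le_iff: "tdeg p \<le> n \<longleftrightarrow> (\<forall>m\<in>Poly_Mapping.keys p. mdeg m \<le> n)"
  by (simp add: tdeg_def)

lemma tdeg_add_le:
  assumes "tdeg p \<le> n" "tdeg q \<le> n"
  shows "tdeg (p + q) \<le> n"
  using assms keys_add[of p q] by (auto simp: tdeg_le_iff)

lemma tdeg_sum_le:
  assumes "\<And>i. i \<in> I \<Longrightarrow> tdeg (f i) \<le> n"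
  shows "tdeg (sum f I) \<le> n"
  using assms keys_sum[of f I] by (fastforce simp: tdeg_le_iff)

lemma tdeg_mult_le:
  fixes p q :: "'d::finite rpoly"
  assumes "tdeg p \<le> m" "tdeg q \<le> n"
  shows "tdeg (p * q) \<le> m + n"
  unfolding tdeg_le_iff
proof
  fix k assume "k \<in> Poly_Mapping.keys (p * q)"
  then obtain a b where "k = a + b" "a \<in> Poly_Mapping.keys p" "b \<in> Poly_Mapping.keys q"
    using keys_mult[of p q] by auto
  then show "mdeg k \<le> m + n"
    using assms by (simp add: mdeg_add add_mono tdeg_le_iff)
qed

lemma tdeg_cst: "tdeg (cst c :: 'd rpoly) = 0"
  by (cases "c = 0") (simp_all add: tdeg_def cst_def mdeg_def)

lemma one_eq_cst: "1 = (cst 1 :: 'd rpoly)"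
  by (simp add: cst_def)

lemma tdeg_one: "tdeg (1 :: 'd rpoly) = 0"
  unfolding one_eq_cst by (rule tdeg_cst)

lemma tdeg_cst_mult_le:
  fixes p :: "'d::finite rpoly"
  assumes "tdeg p \<le> n"
  shows "tdeg (cst c * p) \<le> n"
  using tdeg_mult_le[of "cst c" 0 p n] assms by (simp add: tdeg_cst)

lemma tdeg_monomial: "tdeg (Poly_Mapping.single m (1::real)) = mdeg m"
  by (simp add: tdeg_def)

lemma tdeg_var: "tdeg (var (i::'d::finite)) = 1"
  by (simp add: var_def tdeg_monomial mdeg_single)

lemma tdeg_power_le:
  fixes p :: "'d::finite rpoly"
  assumes "tdeg p \<le> m"
  shows "tdeg (p ^ n) \<le> n * m"
proof (induction n)
  case (Suc n)
  then show ?case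
    using tdeg_mult_le[OF assms Suc] by simp
qed (simp add: tdeg_one)

lemma tdeg_prod_le:
  fixes f :: "'i \<Rightarrow> 'd::finite rpoly"
  assumes "finite I" "\<And>i. i \<in> I \<Longrightarrow> tdeg (f i) \<le> m"
  shows "tdeg (prod f I) \<le> card I * m"
  using assms
proof (induction I rule: finite_induct)
  case (insert i I)
  then have "tdeg (f i * prod f I) \<le> m + card I * m"
    by (intro tdeg_mult_le) auto
  then show ?case
    using insert by simp
qed (simp add: tdeg_one)

lemma tdeg_tensor_power_le:
  fixes a :: "'r::finite \<Rightarrow> 'd::finite"
  shows "tdeg (tensor_power a) \<le> CARD('r)"
  unfolding tensor_power_def using tdeg_prod_le[of UNIV "\<lambda>j. var (a j)" 1] by (simp add: tdeg_var)

lemma tdeg_norm_sq_power_le: "tdeg (norm_sq ^ n :: 'd::finite rpoly) \<le> 2 * n"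
proof -
  have "tdeg (norm_sq :: 'd rpoly) \<le> 2"
    unfolding norm_sq_def using tdeg_power_le[of "var _" 1 2] by (intro tdeg_sum_le) (simp add: tdeg_var)
  from tdeg_power_le[OF this, of n] show ?thesis by simp
qed

lemma sum_monomials: "(\<Sum>m\<in>Poly_Mapping.keys p. Poly_Mapping.single m (Poly_Mapping.lookup p m)) = p"
  by (rule poly_mapping_eqI) (auto simp: lookup_sum lookup_single when_def in_keys_iff)

lemma lookup_cst_mult: "Poly_Mapping.lookup (cst c * p) m = c * Poly_Mapping.lookup p m"
proof -
  have "cst c * p = Poly_Mapping.map ((*) c) p"
    by (simp add: cst_def mult_map_scale_conv_mult)
  then show ?thesis
    by (simp add: Poly_Mapping.map.rep_eq when_def)
qed

lemma cst_mult_single: "cst c * Poly_Mapping.single m 1 = Poly_Mapping.single m c"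
  by (simp add: cst_def mult_single)

lemma cst_add: "cst (a + b) = cst a + cst b"
  by (simp add: cst_def single_add)

lemma cst_times: "cst (a * b) = cst a * cst b"
  by (simp add: cst_def mult_single)

lemma mult_eq_sum_monomials:
  "p * q = (\<Sum>m\<in>Poly_Mapping.keys p. \<Sum>n\<in>Poly_Mapping.keys q.
    Poly_Mapping.single (m + n) (Poly_Mapping.lookup p m * Poly_Mapping.lookup q n))"
  (is "_ = ?R")
proof -
  have "p * q = (\<Sum>m\<in>Poly_Mapping.keys p. Poly_Mapping.single m (Poly_Mapping.lookup p m)) *
      (\<Sum>n\<in>Poly_Mapping.keys q. Poly_Mapping.single n (Poly_Mapping.lookup q n))"
    by (simp add: sum_monomials)
  also have "\<dots> = ?R"
    by (simp only: sum_product mult_single)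
  finally show ?thesis .
qed

section \<open>Degrees of the terms in a sum of squares\<close>

text \<open>Parallelogram identity: with \<open>b = 2 m - a\<close>, twice the squared distance of
  \<open>a\<close> from \<open>m\<close> equals \<open>N a + N b - 2 * N m\<close>, which is at most
  0.\<close>

lemma sq_norm_midpoint_strict:
  fixes a b m :: "'d::finite \<Rightarrow>\<^sub>0 nat"
  defines "N \<equiv> \<lambda>k. \<Sum>i\<in>UNIV. (Poly_Mapping.lookup k i)^2"
  assumes sum: "a + b = m + m" and "N a \<le> N m" "N b \<le> N m"
  shows "a = m"
proof -
  have e: "Poly_Mapping.lookup a i + Poly_Mapping.lookup b i = 2 * Poly_Mapping.lookup m i" for i
    using sum lookup_add[of a b i] lookup_add[of m m i] by simp
  \<comment> \<open>Passing to reals avoids truncated subtraction of exponents.\<close>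
  let ?r = "\<lambda>k i. real (Poly_Mapping.lookup k i)"
  have rb: "?r b i = 2 * ?r m i - ?r a i" for i
    using e[of i] by linarith
  have "(?r a i - ?r m i)^2 * 2 = (?r a i)^2 + (?r b i)^2 - 2 * (?r m i)^2" for i
    unfolding rb by (simp add: power2_eq_square algebra_simps)
  then have "(\<Sum>i\<in>UNIV. (?r a i - ?r m i)^2) * 2 = (\<Sum>i\<in>UNIV. (?r a i)^2) + (\<Sum>i\<in>UNIV. (?r b i)^2) - 2 * (\<Sum>i\<in>UNIV. (?r m i)^2)"
    by (simp only: sum_distrib_right sum_distrib_left sum_subtractf sum.distrib)
  also have "\<dots> = real (N a) + real (N b) - 2 * real (N m)"
    by (simp add: N_def)
  also have "\<dots> \<le> 0"
    using assms(3,4) by linarith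
  finally have "(\<Sum>i\<in>UNIV. (?r a i - ?r m i)^2) \<le> 0" by simp
  then have "(\<Sum>i\<in>UNIV. (?r a i - ?r m i)^2) = 0"
    by (intro antisym sum_nonneg) auto
  then have "?r a i = ?r m i" for i
    by (subst (asm) sum_nonneg_eq_0_iff) auto
  then show ?thesis
    by (intro poly_mapping_eqI) simp
qed

text \<open>
  No cancellation occurs at \<open>m + m\<close> when \<open>m\<close> has the largest Euclidean norm among the monomials of
  top degree: by strict convexity of the norm, \<open>a + b = m + m\<close> forces \<open>a = b = m\<close>.
\<close>

lemma tdeg_sum_of_squares:
  fixes qs :: "'d::finite rpoly list"
  assumes deg: "tdeg (\<Sum>q\<leftarrow>qs. q^2) \<le> 2 * n" and q: "q \<in> set qs"
  shows "tdeg q \<le> n"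
proof (rule ccontr)
  assume "\<not> tdeg q \<le> n"
  define T where "T = (\<Union>q\<in>set qs. Poly_Mapping.keys q)"
  have T: "finite T" by (simp add: T_def)
  have kT: "Poly_Mapping.keys q \<subseteq> T" if "q \<in> set qs" for q using that by (auto simp: T_def)
  obtain m1 where m1: "m1 \<in> T" "mdeg m1 > n"
    using \<open>\<not> tdeg q \<le> n\<close> q by (auto simp: tdeg_le_iff T_def not_le)
  define D where "D = Max (mdeg ` T)"
  have D: "mdeg m \<le> D" if "m \<in> T" for m using that T by (simp add: D_def)
  define T' where "T' = {m\<in>T. mdeg m = D}"
  have "D \<in> mdeg ` T" unfolding D_def using T m1 by (intro Max_in) auto
  then have "T' \<noteq> {}" "finite T'" using T by (auto simp: T'_def)
  define N where "N = (\<lambda>k :: 'd \<Rightarrow>\<^sub>0 nat. \<Sum>i\<in>UNIV. (Poly_Mapping.lookup k i)^2)"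
  obtain m where m: "m \<in> T'" "\<And>k. k \<in> T' \<Longrightarrow> N k \<le> N m"
    using Max_in[of "N ` T'"] Max_ge[of "N ` T'"] \<open>finite T'\<close> \<open>T' \<noteq> {}\<close> by fastforce
  have only: "a = m \<and> b = m" if ab: "a \<in> T" "b \<in> T" "a + b = m + m" for a b
  proof -
    have "mdeg a + mdeg b = D + D"
      using arg_cong[OF ab(3), of mdeg] m(1) by (simp add: T'_def mdeg_add)
    with D[OF ab(1)] D[OF ab(2)] have "a \<in> T'" "b \<in> T'"
      using ab(1,2) by (auto simp: T'_def)
    then show ?thesis
      using sq_norm_midpoint_strict[of a b m] sq_norm_midpoint_strict[of b a m] ab(3) m(2)
      by (simp add: N_def add.commute)
  qed
  \<comment> \<open>By \<open>only\<close>, just the \<open>m\<close>-coefficient times itself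
    contributes; such squares cannot cancel when added over \<open>qs\<close>.\<close>
  have sq: "Poly_Mapping.lookup (q^2) (m + m) = (Poly_Mapping.lookup q m)^2" if q: "q \<in> set qs" for q
  proof -
    have "Poly_Mapping.lookup (q^2) (m + m) = (\<Sum>a\<in>Poly_Mapping.keys q. \<Sum>b\<in>Poly_Mapping.keys q.
        (Poly_Mapping.lookup q a * Poly_Mapping.lookup q b when a + b = m + m))"
      by (simp add: power2_eq_square mult_eq_sum_monomials[of q q] lookup_sum lookup_single)
    also have "\<dots> = (\<Sum>a\<in>Poly_Mapping.keys q. \<Sum>b\<in>Poly_Mapping.keys q.
        if a = m then if b = m then Poly_Mapping.lookup q a * Poly_Mapping.lookup q b else 0 else 0)"
      using only kT[OF q] by (intro sum.cong refl) (auto simp: when_def)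
    also have "\<dots> = (\<Sum>a\<in>Poly_Mapping.keys q. if a = m then (Poly_Mapping.lookup q m)^2 else 0)"
      by (intro sum.cong refl) (auto simp: power2_eq_square in_keys_iff)
    also have "\<dots> = (Poly_Mapping.lookup q m)^2"
      by (simp add: in_keys_iff)
    finally show ?thesis .
  qed
  have "Poly_Mapping.lookup (\<Sum>q\<leftarrow>rs. q^2) (m + m) = (\<Sum>q\<leftarrow>rs. (Poly_Mapping.lookup q m)^2)"
    if "set rs \<subseteq> set qs" for rs
    using that by (induction rs) (simp_all add: lookup_add sq)
  then have "Poly_Mapping.lookup (\<Sum>q\<leftarrow>qs. q^2) (m + m) = (\<Sum>q\<leftarrow>qs. (Poly_Mapping.lookup q m)^2)"
    by simp
  moreover have "(\<Sum>q\<leftarrow>qs. (Poly_Mapping.lookup q m)^2) \<noteq> 0"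
  proof -
    obtain q where "q \<in> set qs" "Poly_Mapping.lookup q m \<noteq> 0"
      using m(1) by (auto simp: T'_def T_def in_keys_iff)
    then show ?thesis
      by (subst sum_list_nonneg_eq_0_iff) auto
  qed
  ultimately have "m + m \<in> Poly_Mapping.keys (\<Sum>q\<leftarrow>qs. q^2)"
    by (simp add: in_keys_iff)
  then have "mdeg (m + m) \<le> 2 * n"
    using deg by (simp add: tdeg_le_iff)
  moreover have "mdeg m > n"
    using m(1) m1 D[OF m1(1)] by (simp add: T'_def)
  ultimately show False
    by (simp add: mdeg_add)
qed

section \<open>Point evaluations as pseudoexpectations\<close>

definition eval_poly :: "('d::finite \<Rightarrow> real) \<Rightarrow> 'd rpoly \<Rightarrow> real" where
  "eval_poly x p = (\<Sum>m\<in>Poly_Mapping.keys p. Poly_Mapping.lookup p m * (\<Prod>i\<in>UNIV. x i ^ Poly_Mapping.lookup m i))"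

lemma eval_poly_superset:
  assumes "finite T" "Poly_Mapping.keys p \<subseteq> T"
  shows "eval_poly x p = (\<Sum>m\<in>T. Poly_Mapping.lookup p m * (\<Prod>i\<in>UNIV. x i ^ Poly_Mapping.lookup m i))"
  unfolding eval_poly_def using assms by (intro sum.mono_neutral_left) (auto simp: in_keys_iff)

lemma eval_poly_add: "eval_poly x (p + q) = eval_poly x p + eval_poly x q"
  using keys_add[of p q]
  by (simp add: eval_poly_superset[of "Poly_Mapping.keys p \<union> Poly_Mapping.keys q"] lookup_add
      distrib_right sum.distrib)

lemma eval_poly_sum: "eval_poly x (sum f I) = (\<Sum>i\<in>I. eval_poly x (f i))"
  by (induction I rule: infinite_finite_induct) (simp_all add: eval_poly_add, simp_all add: eval_poly_def)

lemma eval_poly_single: "eval_poly x (Poly_Mapping.single m c) = c * (\<Prod>i\<in>UNIV. x i ^ Poly_Mapping.lookup m i)"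
  by (simp add: eval_poly_def)

lemma eval_poly_mult: "eval_poly x (p * q) = eval_poly x p * eval_poly x q"
proof -
  have "eval_poly x (p * q) = (\<Sum>m\<in>Poly_Mapping.keys p. \<Sum>n\<in>Poly_Mapping.keys q.
      (Poly_Mapping.lookup p m * Poly_Mapping.lookup q n) * (\<Prod>i\<in>UNIV. x i ^ Poly_Mapping.lookup (m + n) i))"
    by (simp add: mult_eq_sum_monomials[of p q] eval_poly_sum eval_poly_single)
  also have "\<dots> = eval_poly x p * eval_poly x q"
    by (simp add: eval_poly_def sum_product lookup_add power_add prod.distrib mult_ac)
  finally show ?thesis .
qed

lemma eval_poly_cst: "eval_poly x (cst c) = c"
  by (simp add: cst_def eval_poly_single)

lemma eval_poly_var: "eval_poly x (var i) = x i"
proof -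
  have "(\<Prod>j\<in>UNIV. x j ^ (1 when i = j)) = (\<Prod>j\<in>UNIV. if j = i then x j else 1)"
    by (intro prod.cong) (auto simp: when_def)
  then show ?thesis
    by (simp add: var_def eval_poly_single lookup_single)
qed

text \<open>Evaluation is a ring homomorphism, so squares go to squares, and multiples of
  \<open>norm_sq - 1\<close> go to 0 at points of the unit sphere.\<close>

lemma eval_poly_mem_sphere_pseudoexpectations:
  fixes x :: "'d::finite \<Rightarrow> real"
  assumes "(\<Sum>i\<in>UNIV. (x i)^2) = 1"
  shows "eval_poly x \<in> sphere_pseudoexpectations D"
proof -
  have 1: "eval_poly x 1 = 1"
    by (simp only: one_eq_cst eval_poly_cst)
  have "eval_poly x norm_sq = 1"
    using assms by (simp add: norm_sq_def eval_poly_sum power2_eq_square eval_poly_mult eval_poly_var)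
  then have "eval_poly x (norm_sq - 1) = 0"
    using eval_poly_add[of x "norm_sq - 1" 1] 1 by simp
  then show ?thesis
    by (simp add: sphere_pseudoexpectations_def pseudoexpectation_def satisfies_eq_def 1 eval_poly_add
        eval_poly_mult eval_poly_cst power2_eq_square)
qed

lemma sphere_pseudoexpectations_nonempty: "sphere_pseudoexpectations D \<noteq> ({} :: ('d::finite rpoly \<Rightarrow> real) set)"
proof -
  \<comment> \<open>A coordinate vector; \<open>undefined\<close> serves as an arbitrary
    index.\<close>
  let ?x = "\<lambda>i. if i = (undefined :: 'd) then 1 else 0 :: real"
  have "(\<Sum>i\<in>UNIV. (?x i)^2) = 1"
    by (simp add: if_distrib[of "\<lambda>t. t^2"] cong: if_cong)
  then show ?thesis
    using eval_poly_mem_sphere_pseudoexpectations[of ?x D] by blast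
qed

section \<open>Pseudoexpectations on the sphere\<close>

lemma cst_minus_one_mult: "cst (-1) * p = - p"
  by (simp add: cst_def single_uminus)

locale sphere_pseudoexpectation =
  fixes n :: nat and L :: "'d::finite rpoly \<Rightarrow> real"
  assumes mem: "L \<in> sphere_pseudoexpectations (2 * n)"
begin

lemma add: "tdeg p \<le> 2 * n \<Longrightarrow> tdeg q \<le> 2 * n \<Longrightarrow> L (p + q) = L p + L q"
  and cst_mult: "tdeg p \<le> 2 * n \<Longrightarrow> L (cst c * p) = c * L p"
  and one: "L 1 = 1"
  and square_nonneg: "tdeg p \<le> n \<Longrightarrow> L (p^2) \<ge> 0"
  and eq_zero: "tdeg (p * (norm_sq - 1)) \<le> 2 * n \<Longrightarrow> L (p * (norm_sq - 1)) = 0"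
  using mem by (auto simp: sphere_pseudoexpectations_def pseudoexpectation_def satisfies_eq_def)

lemma zero: "L 0 = 0"
  using cst_mult[of 1 0] by (simp add: tdeg_one cst_def)

lemma diff: "tdeg p \<le> 2 * n \<Longrightarrow> tdeg q \<le> 2 * n \<Longrightarrow> L (p - q) = L p - L q"
  using add[of p "cst (-1) * q"] cst_mult[of q "-1"] tdeg_cst_mult_le[of q "2 * n" "-1"]
  by (simp add: cst_minus_one_mult)

lemma sum: "(\<And>i. i \<in> I \<Longrightarrow> tdeg (f i) \<le> 2 * n) \<Longrightarrow> L (sum f I) = (\<Sum>i\<in>I. L (f i))"
proof (induction I rule: infinite_finite_induct)
  case (insert i I)
  then show ?case
    by (simp add: add tdeg_sum_le)
qed (simp_all add: zero)

text \<open>The room of 2 in the degree is what the constraint needs, as \<open>norm_sq - 1\<close>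
  has degree at most 2.\<close>

lemma mult_norm_sq:
  assumes "tdeg p + 2 \<le> 2 * n"
  shows "L (p * norm_sq) = L p"
proof -
  have "norm_sq - 1 = norm_sq ^ 1 + (cst (-1) :: 'd rpoly)"
    using cst_minus_one_mult[of "1 :: 'd rpoly"] by simp
  moreover have "tdeg (norm_sq ^ 1 + (cst (-1) :: 'd rpoly)) \<le> 2"
    using tdeg_norm_sq_power_le[of 1, where 'd = 'd] by (intro tdeg_add_le) (simp_all add: tdeg_cst)
  ultimately have "tdeg (norm_sq - 1 :: 'd rpoly) \<le> 2"
    by (simp only:)
  then have deg: "tdeg (p * (norm_sq - 1)) \<le> 2 * n"
    using tdeg_mult_le[of p "tdeg p" "norm_sq - 1" 2] assms by simp
  have "L (p * (norm_sq - 1) + p) = L (p * (norm_sq - 1)) + L p"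
    using assms by (intro add deg) simp
  then show ?thesis
    using eq_zero[OF deg] by (simp add: algebra_simps)
qed

lemma norm_sq_power: "j \<le> n \<Longrightarrow> L (norm_sq ^ j) = 1"
proof (induction j)
  case (Suc j)
  have "L (norm_sq ^ j * norm_sq) = L (norm_sq ^ j)"
    using tdeg_norm_sq_power_le[of j, where 'd = 'd] Suc.prems by (intro mult_norm_sq) linarith
  then show ?case
    using Suc by (simp add: mult.commute)
qed (simp add: one)

text \<open>Induction on the degree. Splitting off a variable \<open>var i\<close> leaves a monomial
  \<open>?q\<close>, and \<open>(var i * ?q)^2\<close> is one of the summands of
  \<open>?q^2 * norm_sq\<close>. All these summands have nonnegative value, and the total has the
  value of \<open>?q^2\<close>.\<close>

lemma square_monomial_le_one:
  "mdeg m \<le> n \<Longrightarrow> L (Poly_Mapping.single m 1 ^ 2) \<le> 1"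
proof (induction "mdeg m" arbitrary: m)
  case 0
  then have "m = 0"
    by (auto simp: mdeg_eq_sum intro: poly_mapping_eqI)
  then show ?case
    by (simp add: one)
next
  case (Suc k)
  then have "\<exists>i. Poly_Mapping.lookup m i \<noteq> 0"
    by (metis mdeg_eq_sum nat.distinct(1) sum.neutral)
  then obtain i where i: "Poly_Mapping.lookup m i \<noteq> 0" ..
  define m' where "m' = m - Poly_Mapping.single i 1"
  have m: "m = Poly_Mapping.single i 1 + m'"
    unfolding m'_def using i
    by (intro poly_mapping_eqI) (auto simp: lookup_add lookup_minus lookup_single when_def)
  then have k: "mdeg m' = k"
    using Suc.hyps(2) by (simp add: mdeg_add mdeg_single)
  let ?q = "Poly_Mapping.single m' 1 :: 'd rpoly"
  have q: "tdeg (var j * ?q) \<le> n" for j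
    using tdeg_mult_le[of "var j" 1 ?q k] Suc.hyps(2) Suc.prems by (simp add: tdeg_var tdeg_monomial k)
  have q2: "tdeg ((var j * ?q)^2) \<le> 2 * n" for j
    using tdeg_power_le[OF q] by simp
  have "L ((var i * ?q)^2) \<le> (\<Sum>j\<in>UNIV. L ((var j * ?q)^2))"
    using square_nonneg[OF q] by (intro member_le_sum) auto
  also have "\<dots> = L (\<Sum>j\<in>UNIV. (var j * ?q)^2)"
    by (rule sum[symmetric]) (rule q2)
  also have "(\<Sum>j\<in>UNIV. (var j * ?q)^2) = ?q^2 * norm_sq"
    by (simp only: norm_sq_def sum_distrib_left power_mult_distrib mult.commute)
  also have "L \<dots> = L (?q^2)"
    using tdeg_power_le[of ?q k 2] Suc.hyps(2) Suc.prems
    by (intro mult_norm_sq) (simp add: tdeg_monomial k)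
  also have "\<dots> \<le> 1"
    using Suc.hyps Suc.prems k by simp
  also have "var i * ?q = Poly_Mapping.single m 1"
    by (simp add: var_def mult_single m)
  finally show ?case .
qed

text \<open>Variables are moved one at a time from the second factor to the first. The split brings
  both factors into the degree range where positivity of squares is available.\<close>

lemma monomial_split:
  fixes m :: "'d \<Rightarrow>\<^sub>0 nat"
  assumes "mdeg m \<le> 2 * n"
  obtains a b where "m = a + b" "mdeg a \<le> n" "mdeg b \<le> n"
proof -
  have "\<exists>a b. m = a + b \<and> mdeg a = j" if "j \<le> mdeg m" for j
    using that
  proof (induction j)
    case 0
    show ?case
      by (intro exI[of _ 0] exI[of _ m]) (simp add: mdeg_def)
  next
    case (Suc j)
    then obtain a b where ab: "m = a + b" "mdeg a = j" by auto
    with Suc.prems have "mdeg b \<noteq> 0" by (simp add: mdeg_add)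
    then obtain i where i: "Poly_Mapping.lookup b i \<noteq> 0"
      by (metis mdeg_eq_sum sum.neutral)
    have "m = (a + Poly_Mapping.single i 1) + (b - Poly_Mapping.single i 1)"
      unfolding ab(1) using i
      by (intro poly_mapping_eqI) (auto simp: lookup_add lookup_minus lookup_single when_def)
    then show ?case
      using ab(2) by (metis mdeg_add mdeg_single Suc_eq_plus1)
  qed
  from this[of "min n (mdeg m)"] obtain a b where "m = a + b" "mdeg a = min n (mdeg m)" by auto
  then show ?thesis
    using assms that[of a b] by (auto simp: mdeg_add)
qed

text \<open>Cauchy-Schwarz in elementary form: split the monomial into halves \<open>?a\<close> and
  \<open>?b\<close>, expand the square of \<open>?a + cst c * ?b\<close> at \<open>c = 1\<close> and
  \<open>c = -1\<close>, and bound both pure squares by 1.\<close>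

lemma abs_monomial_le_one:
  assumes "mdeg m \<le> 2 * n"
  shows "\<bar>L (Poly_Mapping.single m 1)\<bar> \<le> 1"
proof -
  obtain a b where ab: "m = a + b" "mdeg a \<le> n" "mdeg b \<le> n"
    using monomial_split[OF assms] .
  let ?a = "Poly_Mapping.single a 1 :: 'd rpoly" and ?b = "Poly_Mapping.single b 1 :: 'd rpoly"
  have da: "tdeg ?a \<le> n" and db: "tdeg ?b \<le> n" using ab by (simp_all add: tdeg_monomial)
  have d2: "tdeg (?a^2) \<le> 2 * n" "tdeg (?b^2) \<le> 2 * n" "tdeg (?a * ?b) \<le> 2 * n"
    using tdeg_power_le[OF da, of 2] tdeg_power_le[OF db, of 2] tdeg_mult_le[OF da db] by simp_all
  have *: "0 \<le> L (?a^2) + 2 * c * L (?a * ?b) + c^2 * L (?b^2)" for c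
  proof -
    have "0 \<le> L ((?a + cst c * ?b)^2)"
      by (intro square_nonneg tdeg_add_le da tdeg_cst_mult_le db)
    also have "(?a + cst c * ?b)^2 = ?a^2 + cst (2 * c) * (?a * ?b) + cst (c^2) * ?b^2"
    proof -
      have "cst (2 * c) = cst c + (cst c :: 'd rpoly)" "cst (c^2) = cst c * (cst c :: 'd rpoly)"
        by (simp_all add: power2_eq_square cst_times flip: cst_add)
      then show ?thesis
        by (simp add: power2_eq_square algebra_simps)
    qed
    also have "L \<dots> = L (?a^2) + 2 * c * L (?a * ?b) + c^2 * L (?b^2)"
      by (simp add: add tdeg_add_le tdeg_cst_mult_le cst_mult d2)
    finally show ?thesis .
  qed
  have "L (?a^2) \<le> 1" "L (?b^2) \<le> 1"
    using ab by (simp_all add: square_monomial_le_one)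
  then have "\<bar>L (?a * ?b)\<bar> \<le> 1"
    using *[of 1] *[of "-1"] by (simp add: abs_le_iff)
  then show ?thesis
    by (simp add: mult_single ab(1))
qed

text \<open>The bound does not depend on \<open>L\<close>, so it confines all these functionals to
  one box and yields compactness.\<close>

lemma abs_le_coefficient_sum:
  assumes "tdeg p \<le> 2 * n"
  shows "\<bar>L p\<bar> \<le> (\<Sum>m\<in>Poly_Mapping.keys p. \<bar>Poly_Mapping.lookup p m\<bar>)"
proof -
  have deg: "mdeg m \<le> 2 * n" if "m \<in> Poly_Mapping.keys p" for m
    using assms that by (simp add: tdeg_le_iff)
  have "L p = L (\<Sum>m\<in>Poly_Mapping.keys p. cst (Poly_Mapping.lookup p m) * Poly_Mapping.single m 1)"
    by (simp add: cst_mult_single sum_monomials)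
  also have "\<dots> = (\<Sum>m\<in>Poly_Mapping.keys p. Poly_Mapping.lookup p m * L (Poly_Mapping.single m 1))"
    by (subst sum) (auto intro!: tdeg_cst_mult_le sum.cong cst_mult simp: tdeg_monomial deg)
  also have "\<bar>\<dots>\<bar> \<le> (\<Sum>m\<in>Poly_Mapping.keys p. \<bar>Poly_Mapping.lookup p m\<bar>)"
  proof (rule order_trans[OF sum_abs sum_mono])
    fix m assume "m \<in> Poly_Mapping.keys p"
    then show "\<bar>Poly_Mapping.lookup p m * L (Poly_Mapping.single m 1)\<bar> \<le> \<bar>Poly_Mapping.lookup p m\<bar>"
      using abs_monomial_le_one[OF deg, of m] by (simp add: abs_mult mult_left_le)
  qed
  finally show ?thesis .
qed

text \<open>\<open>sos\<close> puts no degree bound on the squared polynomials, whereas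
  \<open>L\<close> is known to be nonnegative only on squares of polynomials of degree at most
  \<open>n\<close>; \<open>tdeg_sum_of_squares\<close> closes this gap.\<close>

lemma sos_nonneg:
  assumes "sos p" "tdeg p \<le> 2 * n"
  shows "L p \<ge> 0"
proof -
  obtain qs where qs: "p = (\<Sum>q\<leftarrow>qs. q^2)"
    using assms(1) by (auto simp: sos_def)
  have deg: "tdeg q \<le> n" if "q \<in> set qs" for q
    using assms(2) that unfolding qs by (rule tdeg_sum_of_squares)
  have "L (\<Sum>q\<leftarrow>rs. q^2) \<ge> 0 \<and> tdeg (\<Sum>q\<leftarrow>rs. q^2) \<le> 2 * n" if "set rs \<subseteq> set qs" for rs
    using that
  proof (induction rs)
    case (Cons q rs)
    then have q: "tdeg q \<le> n" using deg by auto
    then have q2: "tdeg (q^2) \<le> 2 * n" using tdeg_power_le[OF q, of 2] by simp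
    show ?case
      using Cons square_nonneg[OF q] q2 by (simp add: add tdeg_add_le)
  qed (simp add: zero tdeg_def)
  then show ?thesis
    unfolding qs by blast
qed

end

section \<open>Convexity, compactness and attainment of the maximum\<close>

lemma convex_sphere_pseudoexpectations:
  assumes "L \<in> sphere_pseudoexpectations D" "L' \<in> sphere_pseudoexpectations D"
    and "0 \<le> u" "0 \<le> v" "u + v = 1"
  shows "(\<lambda>p. u * L p + v * L' p) \<in> sphere_pseudoexpectations D"
  using assms
  by (auto simp: sphere_pseudoexpectations_def pseudoexpectation_def satisfies_eq_def algebra_simps)

text \<open>Values above degree \<open>2 * n\<close> are unconstrained, which would destroy
  compactness; setting them to 0 leaves all relevant values unchanged.\<close>

lemma truncate_sphere_pseudoexpectation:
  fixes L :: "'d::finite rpoly \<Rightarrow> real"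
  assumes "L \<in> sphere_pseudoexpectations (2 * n)"
  shows "(\<lambda>p. if tdeg p \<le> 2 * n then L p else 0) \<in> sphere_pseudoexpectations (2 * n)"
proof -
  have "tdeg (p^2) \<le> 2 * n" if "2 * tdeg p \<le> 2 * n" for p :: "'d rpoly"
    using tdeg_power_le[of p "tdeg p" 2] that by simp
  then show ?thesis
    using assms
    by (auto simp: sphere_pseudoexpectations_def pseudoexpectation_def satisfies_eq_def
        tdeg_add_le tdeg_cst_mult_le tdeg_one)
qed

text \<open>Tychonoff: in the topology of pointwise convergence the truncated functionals form a
  closed subset of a product of compact intervals, and evaluation at \<open>p\<close> is continuous.
  Truncation transfers the maximum to all functionals.\<close>

lemma sphere_pseudoexpectation_attains_max:
  fixes p :: "'d::finite rpoly"
  assumes p: "tdeg p \<le> 2 * n"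
  shows "\<exists>L. is_arg_max (\<lambda>L. L p) (\<lambda>L. L \<in> sphere_pseudoexpectations (2 * n)) L"
proof -
  define B where "B p = (\<Sum>m\<in>Poly_Mapping.keys p. \<bar>Poly_Mapping.lookup p m\<bar>)" for p :: "'d rpoly"
  define S where "S = {L :: 'd rpoly \<Rightarrow> real. L \<in> sphere_pseudoexpectations (2 * n) \<and>
    (\<forall>p. \<not> tdeg p \<le> 2 * n \<longrightarrow> L p = 0)}"
  have "closed S"
    unfolding S_def sphere_pseudoexpectations_def pseudoexpectation_def satisfies_eq_def mem_Collect_eq
    by (intro closed_Collect_conj closed_Collect_all closed_Collect_imp open_Collect_const
        closed_Collect_eq closed_Collect_le continuous_intros continuous_on_product_coordinates)
  moreover have "S \<subseteq> (\<Pi>\<^sub>E p\<in>UNIV. {- B p..B p})"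
  proof
    fix L assume L: "L \<in> S"
    then interpret sphere_pseudoexpectation n L
      by unfold_locales (simp add: S_def)
    have "\<bar>L p\<bar> \<le> B p" for p
      using L abs_le_coefficient_sum[of p]
      by (cases "tdeg p \<le> 2 * n") (auto simp: B_def S_def sum_nonneg)
    then show "L \<in> (\<Pi>\<^sub>E p\<in>UNIV. {- B p..B p})"
      by (auto simp: abs_le_iff minus_le_iff)
  qed
  moreover have "compact (\<Pi>\<^sub>E p\<in>UNIV. {- B p..B p})"
    using compactin_PiE[of "\<lambda>_. euclidean" UNIV "\<lambda>p. {- B p..B p}"]
    by (simp add: euclidean_product_topology)
  ultimately have "compact S"
    by (metis closed_Int_compact inf.absorb1)
  moreover have trunc: "(\<lambda>p. if tdeg p \<le> 2 * n then L p else 0) \<in> S" if "L \<in> sphere_pseudoexpectations (2 * n)" for L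
    using truncate_sphere_pseudoexpectation[OF that] by (simp add: S_def)
  then have "S \<noteq> {}"
    using sphere_pseudoexpectations_nonempty[of "2 * n", where 'd = 'd] by blast
  moreover have "continuous_on S (\<lambda>L. L p)"
    by (intro continuous_on_subset[OF continuous_on_product_coordinates]) auto
  ultimately obtain L where L: "L \<in> S" "\<And>L'. L' \<in> S \<Longrightarrow> L' p \<le> L p"
    using continuous_attains_sup[of S "\<lambda>L. L p"] by blast
  have "L' p \<le> L p" if "L' \<in> sphere_pseudoexpectations (2 * n)" for L'
    using L(2)[OF trunc[OF that]] p by simp
  then show ?thesis
    using L(1) by (intro exI[of _ L]) (auto simp: is_arg_max_linorder S_def)
qed

section \<open>Moment matrices of tensor powers\<close>

definition moment_matrix :: "('d rpoly \<Rightarrow> real) \<Rightarrow> real ^ ('r::finite \<Rightarrow> 'd::finite) ^ ('r \<Rightarrow> 'd)" where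
  "moment_matrix L = (\<chi> a b. L (tensor_power a * tensor_power b))"

lemma tensor_form_eq:
  "tensor_form A = (\<Sum>a\<in>UNIV. \<Sum>b\<in>UNIV. cst (A $ a $ b) * (tensor_power a * tensor_power b))"
  by (simp add: tensor_form_def sum_distrib_left mult_ac)

lemma tdeg_tensor_product_le:
  fixes a b :: "'r::finite \<Rightarrow> 'd::finite"
  shows "tdeg (tensor_power a * tensor_power b) \<le> 2 * CARD('r)"
  using tdeg_mult_le[OF tdeg_tensor_power_le[of a] tdeg_tensor_power_le[of b]] by simp

lemma tdeg_tensor_form_le:
  fixes A :: "real ^ ('r::finite \<Rightarrow> 'd::finite) ^ ('r \<Rightarrow> 'd)"
  shows "tdeg (tensor_form A) \<le> 2 * CARD('r)"
  unfolding tensor_form_eq by (intro tdeg_sum_le tdeg_cst_mult_le tdeg_tensor_product_le)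

lemma tensor_form_add:
  fixes A B :: "real ^ ('r::finite \<Rightarrow> 'd::finite) ^ ('r \<Rightarrow> 'd)"
  shows "tensor_form (A + B) = tensor_form A + tensor_form B"
  by (simp add: tensor_form_eq cst_add distrib_right sum.distrib)

lemma sum_tensor_form:
  fixes A :: "'i \<Rightarrow> real ^ ('r::finite \<Rightarrow> 'd::finite) ^ ('r \<Rightarrow> 'd)"
  shows "(\<Sum>i\<in>I. tensor_form (A i)) = tensor_form (\<Sum>i\<in>I. A i)"
  by (induction I rule: infinite_finite_induct) (simp_all add: tensor_form_add, simp_all add: tensor_form_eq cst_def)

text \<open>Distributing the product of \<open>CARD('r)\<close> copies of \<open>norm_sq\<close>
  gives one summand per multi-index. This is why moment matrices have trace 1.\<close>

lemma sum_tensor_power_squares: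
  "(\<Sum>a\<in>UNIV. tensor_power a * tensor_power (a :: 'r::finite \<Rightarrow> 'd::finite)) = norm_sq ^ CARD('r)"
proof -
  have "norm_sq ^ CARD('r) = (\<Prod>j\<in>(UNIV::'r set). \<Sum>i\<in>(UNIV::'d set). var i ^ 2)"
    by (simp add: norm_sq_def)
  also have "\<dots> = (\<Sum>a\<in>(\<Pi>\<^sub>E j\<in>UNIV. UNIV). \<Prod>j\<in>(UNIV::'r set). var (a j) ^ 2)"
    by (rule prod_sum_PiE) auto
  finally show ?thesis
    by (simp add: tensor_power_def power2_eq_square prod.distrib)
qed

lemma pseudoexpectation_tensor_form:
  fixes L :: "'d::finite rpoly \<Rightarrow> real" and A :: "real ^ ('r::finite \<Rightarrow> 'd) ^ ('r \<Rightarrow> 'd)"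
  assumes "L \<in> sphere_pseudoexpectations (2 * CARD('r))"
  shows "L (tensor_form A) = A \<bullet> moment_matrix L"
proof -
  interpret sphere_pseudoexpectation "CARD('r)" L by unfold_locales fact
  have "L (tensor_form A) = (\<Sum>a\<in>UNIV. L (\<Sum>b\<in>UNIV. cst (A $ a $ b) * (tensor_power a * tensor_power b)))"
    unfolding tensor_form_eq by (intro sum tdeg_sum_le tdeg_cst_mult_le tdeg_tensor_product_le)
  also have "\<dots> = (\<Sum>a\<in>UNIV. \<Sum>b\<in>UNIV. L (cst (A $ a $ b) * (tensor_power a * tensor_power b)))"
    by (intro sum.cong sum refl tdeg_cst_mult_le tdeg_tensor_product_le)
  also have "\<dots> = A \<bullet> moment_matrix L"
    by (simp add: cst_mult tdeg_tensor_product_le inner_vec_def moment_matrix_def)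
  finally show ?thesis .
qed

text \<open>The quadratic form at \<open>u\<close> is the value of \<open>L\<close> on the square of
  a form of degree at most \<open>CARD('r)\<close>, and the trace is its value on
  \<open>norm_sq ^ CARD('r)\<close>.\<close>

lemma density_moment_matrix:
  fixes L :: "'d::finite rpoly \<Rightarrow> real"
  assumes L: "L \<in> sphere_pseudoexpectations (2 * CARD('r::finite))"
  shows "density (moment_matrix L :: real ^ ('r \<Rightarrow> 'd) ^ ('r \<Rightarrow> 'd))"
  unfolding density_def
proof (intro conjI allI)
  let ?X = "moment_matrix L :: real ^ ('r \<Rightarrow> 'd) ^ ('r \<Rightarrow> 'd)"
  interpret sphere_pseudoexpectation "CARD('r)" L by unfold_locales fact
  show "transpose ?X = ?X"
    by (simp add: vec_eq_iff transpose_def moment_matrix_def mult.commute)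
  fix u :: "real ^ ('r \<Rightarrow> 'd)"
  have "u \<bullet> (?X *v u) = (\<chi> a b. u $ a * u $ b) \<bullet> ?X"
    by (simp add: inner_vec_def matrix_vector_mult_def sum_distrib_left mult_ac)
  also have "\<dots> = L (tensor_form (\<chi> a b. u $ a * u $ b))"
    by (rule pseudoexpectation_tensor_form[OF L, symmetric])
  also have "tensor_form (\<chi> a b. u $ a * u $ b) = (\<Sum>a\<in>UNIV. cst (u $ a) * tensor_power a)^2"
    by (simp add: tensor_form_eq power2_eq_square sum_product cst_times mult_ac)
  also have "L \<dots> \<ge> 0"
    by (intro square_nonneg tdeg_sum_le tdeg_cst_mult_le tdeg_tensor_power_le)
  finally show "0 \<le> u \<bullet> (?X *v u)" .
next
  interpret sphere_pseudoexpectation "CARD('r)" L by unfold_locales fact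
  have "trace (moment_matrix L :: real ^ ('r \<Rightarrow> 'd) ^ ('r \<Rightarrow> 'd)) =
      L (\<Sum>a\<in>UNIV. tensor_power a * tensor_power (a :: 'r \<Rightarrow> 'd))"
    by (subst sum) (simp_all add: tdeg_tensor_product_le trace_def moment_matrix_def)
  then show "trace (moment_matrix L :: real ^ ('r \<Rightarrow> 'd) ^ ('r \<Rightarrow> 'd)) = 1"
    by (simp add: sum_tensor_power_squares norm_sq_power)
qed

text \<open>Coefficients of the form are linear in the matrix entries, so the expectation passes
  inside. The polynomial variance hypothesis thereby becomes one on the mean of the squared
  matrix.\<close>

lemma expectation_poly_tensor_form:
  fixes A :: "'w \<Rightarrow> real ^ ('r::finite \<Rightarrow> 'd::finite) ^ ('r \<Rightarrow> 'd)"
  assumes "integrable P A"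
  shows "expectation_poly P (\<lambda>\<omega>. tensor_form (A \<omega>)) = tensor_form (\<integral>\<omega>. A \<omega> \<partial>P)"
proof (rule poly_mapping_eqI)
  fix m
  have lookup: "Poly_Mapping.lookup (tensor_form B) m = (\<Sum>a\<in>UNIV. \<Sum>b\<in>UNIV.
      B $ a $ b * Poly_Mapping.lookup (tensor_power a * tensor_power b) m)"
    for B :: "real ^ ('r \<Rightarrow> 'd) ^ ('r \<Rightarrow> 'd)"
    by (simp add: tensor_form_eq lookup_sum lookup_cst_mult)
  have bl: "bounded_linear (\<lambda>B :: real ^ ('r \<Rightarrow> 'd) ^ ('r \<Rightarrow> 'd). B $ a $ b)" for a b
    by (intro bounded_linear_compose[OF bounded_linear_vec_nth bounded_linear_vec_nth])
  have entry: "integrable P (\<lambda>\<omega>. A \<omega> $ a $ b)" "(\<integral>\<omega>. A \<omega> $ a $ b \<partial>P) = (\<integral>\<omega>. A \<omega> \<partial>P) $ a $ b" for a b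
    by (rule integrable_bounded_linear[OF bl assms], rule integral_bounded_linear[OF bl assms])
  show "Poly_Mapping.lookup (expectation_poly P (\<lambda>\<omega>. tensor_form (A \<omega>))) m =
      Poly_Mapping.lookup (tensor_form (\<integral>\<omega>. A \<omega> \<partial>P)) m"
    unfolding lookup_expectation_tensor_form lookup
    by (subst Bochner_Integration.integral_sum, simp add: entry)
      (simp add: Bochner_Integration.integral_sum entry)
qed

lemma density_set_moment_matrices:
  "density_set (moment_matrix ` sphere_pseudoexpectations (2 * CARD('r)) ::
    (real ^ ('r::finite \<Rightarrow> 'd::finite) ^ ('r \<Rightarrow> 'd)) set)"
proof
  show "convex (moment_matrix ` sphere_pseudoexpectations (2 * CARD('r)) ::
      (real ^ ('r \<Rightarrow> 'd) ^ ('r \<Rightarrow> 'd)) set)"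
  proof (rule convexI)
    fix X Y :: "real ^ ('r \<Rightarrow> 'd) ^ ('r \<Rightarrow> 'd)" and u v :: real
    assume uv: "0 \<le> u" "0 \<le> v" "u + v = 1"
      and "X \<in> moment_matrix ` sphere_pseudoexpectations (2 * CARD('r))"
        "Y \<in> moment_matrix ` sphere_pseudoexpectations (2 * CARD('r))"
    then obtain L L' where L: "L \<in> sphere_pseudoexpectations (2 * CARD('r))" "X = moment_matrix L"
      and L': "L' \<in> sphere_pseudoexpectations (2 * CARD('r))" "Y = moment_matrix L'"
      by auto
    have "u *\<^sub>R X + v *\<^sub>R Y = moment_matrix (\<lambda>p. u * L p + v * L' p)"
      by (simp add: L L' moment_matrix_def vec_eq_iff)
    then show "u *\<^sub>R X + v *\<^sub>R Y \<in> moment_matrix ` sphere_pseudoexpectations (2 * CARD('r))"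
      using convex_sphere_pseudoexpectations[OF L(1) L'(1) uv] by blast
  qed
qed (use sphere_pseudoexpectations_nonempty density_moment_matrix in auto)

section \<open>The maximum as a function of the matrix\<close>

lemma max_pseudoexpectation_attained:
  fixes p :: "'d::finite rpoly"
  assumes "tdeg p \<le> 2 * n"
  obtains L where "L \<in> sphere_pseudoexpectations (2 * n)" "max_pseudoexpectation (2 * n) p = L p"
    "\<And>L'. L' \<in> sphere_pseudoexpectations (2 * n) \<Longrightarrow> L' p \<le> max_pseudoexpectation (2 * n) p"
proof -
  obtain L where L: "L \<in> sphere_pseudoexpectations (2 * n)"
    "\<And>L'. L' \<in> sphere_pseudoexpectations (2 * n) \<Longrightarrow> L' p \<le> L p"
    using sphere_pseudoexpectation_attains_max[OF assms] by (auto simp: is_arg_max_linorder)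
  then have "max_pseudoexpectation (2 * n) p = L p"
    unfolding max_pseudoexpectation_def by (intro Greatest_equality) auto
  with L show ?thesis
    using that[of L] by simp
qed

text \<open>The maximizer for \<open>A\<close> is a competitor for \<open>B\<close>, and its moment
  matrix has norm at most 1. Continuity, hence measurability of the random maximum, follows.\<close>

lemma max_pseudoexpectation_lipschitz:
  fixes A B :: "real ^ ('r::finite \<Rightarrow> 'd::finite) ^ ('r \<Rightarrow> 'd)"
  shows "max_pseudoexpectation (2 * CARD('r)) (tensor_form A)
    \<le> max_pseudoexpectation (2 * CARD('r)) (tensor_form B) + norm (A - B)"
proof -
  obtain L where L: "L \<in> sphere_pseudoexpectations (2 * CARD('r))"
      "max_pseudoexpectation (2 * CARD('r)) (tensor_form A) = L (tensor_form A)"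
    using max_pseudoexpectation_attained[OF tdeg_tensor_form_le[of A]] .
  have "L (tensor_form A) = L (tensor_form B) + (A - B) \<bullet> moment_matrix L"
    by (simp add: pseudoexpectation_tensor_form[OF L(1)] inner_diff_left)
  also have "L (tensor_form B) \<le> max_pseudoexpectation (2 * CARD('r)) (tensor_form B)"
    using max_pseudoexpectation_attained[OF tdeg_tensor_form_le[of B]] L(1) by metis
  also have "(A - B) \<bullet> moment_matrix L \<le> norm (A - B)"
    using density_set.abs_inner_le[OF density_set_moment_matrices imageI[OF L(1)], of "A - B"] by linarith
  finally show ?thesis
    using L(2) by simp
qed

lemma continuous_max_pseudoexpectation:
  "continuous_on UNIV (\<lambda>A :: real ^ ('r::finite \<Rightarrow> 'd::finite) ^ ('r \<Rightarrow> 'd).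
    max_pseudoexpectation (2 * CARD('r)) (tensor_form A))"
proof (rule lipschitz_on_continuous_on[OF lipschitz_onI])
  fix A B :: "real ^ ('r \<Rightarrow> 'd) ^ ('r \<Rightarrow> 'd)"
  show "dist (max_pseudoexpectation (2 * CARD('r)) (tensor_form A))
      (max_pseudoexpectation (2 * CARD('r)) (tensor_form B)) \<le> 1 * dist A B"
    using max_pseudoexpectation_lipschitz[of A B] max_pseudoexpectation_lipschitz[of B A]
    by (simp add: dist_norm norm_minus_commute abs_le_iff)
qed simp

theorem theorem3p3:
  fixes P :: "'w measure"
    and M :: "nat \<Rightarrow> 'w \<Rightarrow> real ^ ('r::finite \<Rightarrow> 'd::finite) ^ ('r \<Rightarrow> 'd)"
    and k :: nat and R \<sigma> :: real
  assumes "prob_space P"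
    and indep: "prob_space.indep_vars P (\<lambda>_. borel) M {..<k}"
    and ident: "\<And>i j. i < k \<Longrightarrow> j < k \<Longrightarrow> distr P borel (M i) = distr P borel (M j)"
    and mean: "\<And>i. i < k \<Longrightarrow> (\<integral>\<omega>. M i \<omega> \<partial>P) = 0"
    and symm: "\<And>i \<omega>. i < k \<Longrightarrow> \<omega> \<in> space P \<Longrightarrow> transpose (M i \<omega>) = M i \<omega>"
    and "R > 0" and "\<sigma> > 0"
    and bound: "\<And>i. i < k \<Longrightarrow> AE \<omega> in P. spectral_norm (M i \<omega>) \<le> R"
    and variance: "\<And>i. i < k \<Longrightarrow>
      expectation_poly P (\<lambda>\<omega>. tensor_form (M i \<omega> ** M i \<omega>)) \<preceq> cst (\<sigma>\<^sup>2) * norm_sq ^ CARD('r)"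
  shows "(\<forall>\<omega>\<in>space P. \<exists>L. is_arg_max (\<lambda>L. L (\<Sum>i<k. tensor_form (M i \<omega>)))
            (\<lambda>L. L \<in> sphere_pseudoexpectations (2 * CARD('r))) L) \<and>
    integrable P (\<lambda>\<omega>. max_pseudoexpectation (2 * CARD('r)) (\<Sum>i<k. tensor_form (M i \<omega>))) \<and>
    (\<integral>\<omega>. max_pseudoexpectation (2 * CARD('r)) (\<Sum>i<k. tensor_form (M i \<omega>)) \<partial>P)
      \<le> 2 * (ln 2 + real CARD('r) * ln (real CARD('d))) / 3 * R
        + 2 * sqrt (2 * real k * (ln 2 + real CARD('r) * ln (real CARD('d)))) * \<sigma>"
proof (intro conjI ballI)
  interpret prob_space P by fact
  let ?r = "CARD('r)"
  let ?N = "real CARD('r \<Rightarrow> 'd)"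
  define K :: "(real ^ ('r \<Rightarrow> 'd) ^ ('r \<Rightarrow> 'd)) set"
    where "K = moment_matrix ` sphere_pseudoexpectations (2 * ?r)"
  interpret density_set K
    unfolding K_def by (rule density_set_moment_matrices)
  define l where "l = ln 2 + real ?r * ln (real CARD('d))"
  define S where "S \<omega> = (\<Sum>i<k. M i \<omega>)" for \<omega>
  let ?max = "\<lambda>A :: real ^ ('r \<Rightarrow> 'd) ^ ('r \<Rightarrow> 'd). max_pseudoexpectation (2 * ?r) (tensor_form A)"
  have form: "(\<Sum>i<k. tensor_form (M i \<omega>)) = tensor_form (S \<omega>)" for \<omega>
    by (simp add: S_def sum_tensor_form)
  show "\<exists>L. is_arg_max (\<lambda>L. L (\<Sum>i<k. tensor_form (M i \<omega>)))
      (\<lambda>L. L \<in> sphere_pseudoexpectations (2 * ?r)) L" for \<omega>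
    unfolding form by (intro sphere_pseudoexpectation_attains_max tdeg_tensor_form_le)
  have meas: "M i \<in> borel_measurable P" if "i < k" for i
    using indep that by (auto simp: indep_vars_def)
  have symm': "\<forall>\<omega>\<in>space P. transpose (M i \<omega>) = M i \<omega>" if "i < k" for i
    using symm that by blast
  note int = integrable_bounded_symmetric[OF meas symm' bound]
  have intS: "integrable P S"
    unfolding S_def using int(2) by (intro Bochner_Integration.integrable_sum) simp
  show int_max: "integrable P (\<lambda>\<omega>. max_pseudoexpectation (2 * ?r) (\<Sum>i<k. tensor_form (M i \<omega>)))"
    unfolding form
  proof (rule Bochner_Integration.integrable_bound)
    show "integrable P (\<lambda>\<omega>. \<bar>?max 0\<bar> + norm (S \<omega>))"
      using intS by simp
    show "(\<lambda>\<omega>. ?max (S \<omega>)) \<in> borel_measurable P"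
      by (rule borel_measurable_continuous_on[OF continuous_max_pseudoexpectation
            borel_measurable_integrable[OF intS]])
    have "norm (?max A) \<le> norm (\<bar>?max 0\<bar> + norm A)" for A
      using max_pseudoexpectation_lipschitz[of A 0] max_pseudoexpectation_lipschitz[of 0 A] by auto
    then show "AE \<omega> in P. norm (?max (S \<omega>)) \<le> norm (\<bar>?max 0\<bar> + norm (S \<omega>))"
      by simp
  qed
  \<comment> \<open>Applying \<open>L\<close> to the sum of squares provided by
    \<open>variance\<close> transfers the bound to \<open>X\<close>, since
    \<open>norm_sq ^ ?r\<close> has value 1.\<close>
  have var: "(\<integral>\<omega>. M i \<omega> ** M i \<omega> \<partial>P) \<bullet> X \<le> \<sigma>^2" if i: "i < k" and X: "X \<in> K" for i X
  proof -
    obtain L where L: "L \<in> sphere_pseudoexpectations (2 * ?r)" "X = moment_matrix L"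
      using X by (auto simp: K_def)
    interpret sphere_pseudoexpectation ?r L by unfold_locales fact
    let ?V = "\<integral>\<omega>. M i \<omega> ** M i \<omega> \<partial>P"
    let ?q = "cst (\<sigma>\<^sup>2) * norm_sq ^ ?r :: 'd rpoly"
    have deg: "tdeg ?q \<le> 2 * ?r"
      by (intro tdeg_cst_mult_le tdeg_norm_sq_power_le)
    have "tdeg (?q - tensor_form ?V) \<le> 2 * ?r"
      using tdeg_add_le[OF deg tdeg_cst_mult_le[OF tdeg_tensor_form_le[of ?V], of "-1"]]
      by (simp add: cst_minus_one_mult)
    then have "0 \<le> L (?q - tensor_form ?V)"
      using variance[OF i] unfolding sos_le_def expectation_poly_tensor_form[OF int(3)[OF i i i]]
      by (intro sos_nonneg) auto
    also have "\<dots> = \<sigma>^2 - ?V \<bullet> X"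
      by (simp add: diff deg tdeg_tensor_form_le cst_mult tdeg_norm_sq_power_le norm_sq_power
          pseudoexpectation_tensor_form[OF L(1)] L(2))
    finally show ?thesis by simp
  qed
  \<comment> \<open>The dimension is \<open>d ^ r\<close>. The extra \<open>ln 2\<close> keeps
    \<open>l\<close> positive even for \<open>d = 1\<close>, as \<open>rate_choice\<close>
    requires.\<close>
  have l: "l > 0" "ln ?N \<le> l"
  proof -
    have "ln ?N = real ?r * ln (real CARD('d))"
      by (simp add: card_fun ln_realpow)
    moreover have "ln (real CARD('d)) \<ge> 0"
      by (simp add: Suc_le_eq)
    ultimately show "l > 0" "ln ?N \<le> l"
      by (simp_all add: l_def add_pos_nonneg)
  qed
  obtain \<eta> where \<eta>: "\<eta> > 0" "\<eta> * R \<le> 3/2"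
    "l / \<eta> + \<eta> * (real k * \<sigma>^2) \<le> 2 * l / 3 * R + 2 * sqrt (l * (real k * \<sigma>^2))"
    using rate_choice[of l R "real k * \<sigma>^2"] l(1) \<open>R > 0\<close> by auto
  note pot = expected_potential_sum_le[OF \<open>prob_space P\<close> indep mean symm' \<open>R > 0\<close> bound var \<eta>(1,2)]
  have "?max (S \<omega>) \<le> potential \<eta> K (S \<omega>)" for \<omega>
  proof -
    obtain L where L: "L \<in> sphere_pseudoexpectations (2 * ?r)" "?max (S \<omega>) = L (tensor_form (S \<omega>))"
      using max_pseudoexpectation_attained[OF tdeg_tensor_form_le[of "S \<omega>"]] .
    then show ?thesis
      using inner_le_potential[OF \<eta>(1), of "moment_matrix L" "S \<omega>"]
      by (simp add: pseudoexpectation_tensor_form K_def)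
  qed
  then have "(\<integral>\<omega>. ?max (S \<omega>) \<partial>P) \<le> (\<integral>\<omega>. potential \<eta> K (S \<omega>) \<partial>P)"
    using int_max pot(1) unfolding form S_def[symmetric] by (intro integral_mono) auto
  also have "\<dots> \<le> ln ?N / \<eta> + real k * (\<eta> * \<sigma>^2)"
    using pot(2) by (simp add: S_def)
  also have "\<dots> \<le> l / \<eta> + \<eta> * (real k * \<sigma>^2)"
    using l(2) \<eta>(1) by (simp add: divide_right_mono mult_ac)
  also have "\<dots> \<le> 2 * l / 3 * R + 2 * sqrt (l * (real k * \<sigma>^2))"
    by (rule \<eta>(3))
  \<comment> \<open>The optimization over \<eta> yields the root without the factor 2 inside; that
    factor is slack.\<close>
  also have "\<dots> \<le> 2 * l / 3 * R + 2 * (sqrt (2 * real k * l) * \<sigma>)"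
  proof -
    have "sqrt (l * (real k * \<sigma>^2)) \<le> sqrt (2 * real k * l * \<sigma>^2)"
      using l(1) by (intro real_sqrt_le_mono) (simp add: mult_ac)
    also have "\<dots> = sqrt (2 * real k * l) * \<sigma>"
      using \<open>\<sigma> > 0\<close> by (simp add: real_sqrt_mult)
    finally show ?thesis by simp
  qed
  finally show "(\<integral>\<omega>. max_pseudoexpectation (2 * ?r) (\<Sum>i<k. tensor_form (M i \<omega>)) \<partial>P)
      \<le> 2 * (ln 2 + real ?r * ln (real CARD('d))) / 3 * R
        + 2 * sqrt (2 * real k * (ln 2 + real ?r * ln (real CARD('d)))) * \<sigma>"
    by (simp add: form l_def)
qed

end
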